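(* Let $X,Y$ be sets and let $a$ be a partial function from $Y$ to $X$. Let $A=\operatorname{im}(a)=\{a_i:i\in I\}$ (with $i\mapsto a_i$ injective), $A_i=a_ia^{-1}$, $\lambda_i=|A_i|$ for $i\in I$, $\Lambda_K=\prod_{k\in K}\lambda_k$ for $K\subseteq I$, $\alpha=\operatorname{rank}(a)=|I|$ and $\beta=|X\setminus\operatorname{im}(a)|$. Let $P^a=\operatorname{Reg}(\mathcal{PT}_{XY}^a)$. Let $f\in P^a$, let $\mu=\operatorname{rank}(f)$, and write $f=\binom{F_j}{f_j}_{j\in J}$ where $J\subseteq I$ and $f_j\in A_j$ for each $j\in J$ (this is possible for every $f\in P^a$, with $J=\{i\in I:\operatorname{im}(f)\cap A_i\neq\emptyset\}$). Then: (i) $\widehat R_f^a$ is the union of $(\mu+1)^\beta$ $\mathscr R^a$-classes of $P^a$. (ii) $\widehat L_f^a$ is the union of $\Lambda_J$ $\mathscr L^a$-classes of $P^a$. (iii) $\widehat H_f^a$ is the union of $(\mu+1)^\beta\Lambda_J$ $\mathscr H^a$-classes of $P^a$, each of which has size $\mu!$. (iv) If $H_{\overline f}$ is a non-group $\mathscr H$-class of $\mathcal{PT}_A$, then each $\mathscr H^a$-class of $P^a$ contained in $\widehat H_f^a$ is a non-group. (v) If $H_{\overline f}$ is a group $\mathscr H$-class of $\mathcal{PT}_A$, then each $\mathscr H^a$-class of $P^a$ contained in $\widehat H_f^a$ is a group isomorphic to the symmetric group $\mathcal S_\mu$. Further, $\widehat H_f^a$ is a $(\mu+1)^\beta\times\Lambda_J$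 rectangular group over $\mathcal S_\mu$. (vi) $\widehat D_f^a=D_f^a=D_\mu^a=\{g\in P^a:\operatorname{rank}(g)=\mu\}$ is the union of: (a) $(\mu+1)^\beta S(\alpha+1,\mu+1)$ $\mathscr R^a$-classes of $P^a$; (b) $\sum_{K\subseteq I,\,|K|=\mu}\Lambda_K$ $\mathscr L^a$-classes of $P^a$; (c) $(\mu+1)^\beta S(\alpha+1,\mu+1)\sum_{K\subseteq I,\,|K|=\mu}\Lambda_K$ $\mathscr H^a$-classes of $P^a$.
   Context: Maps are written on the right and composed left to right. $\mathcal{PT}_{XY}$ is the set of all partial functions $X\to Y$; $\mathcal{PT}_{XY}^a$ is the semigroup $(\mathcal{PT}_{XY},\star_a)$ with $f\star_ag=fag$; $\operatorname{Reg}(\mathcal{PT}_{XY}^a)$ is its set of regular elements, which is a subsemigroup. $\mathcal{PT}_A$ is the semigroup of all partial functions $A\to A$ under composition. $f=\binom{F_j}{f_j}_{j\in J}$ means $\operatorname{dom}(f)=\bigcup_jF_j$, $\operatorname{im}(f)=\{f_j:j\in J\}$ with the $f_j$ distinct, and $F_j=f_jf^{-1}$. $\operatorname{rank}(f)=|\operatorname{im}(f)|$. There is a surjective homomorphism $P^a\to\mathcal{PT}_A:f\mapsto\overline f$, where $\overline f=(fa)|_A$ is the restriction of $fa$ to $A\cap\operatorname{dom}(fa)$. $\mathscr R^a,\mathscr L^a,\mathscr H^a,\mathscr D^a$ are Green's relations on the semigroup $P^a$ (which are the restrictions to $P^a$ of those on $\mathcal{PT}_{XY}^a$), and $D_f^a$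 is the $\mathscr D^a$-class of $f$. For $\mathscr K\in\{\mathscr R,\mathscr L,\mathscr H,\mathscr D\}$ and $f,g\in P^a$, write $f\mathrel{\widehat{\mathscr K}^a}g$ if $\overline f\mathrel{\mathscr K}\overline g$ in $\mathcal{PT}_A$; $\widehat K_f^a$ is the $\widehat{\mathscr K}^a$-class of $f$ in $P^a$. $H_{\overline f}$ is the $\mathscr H$-class of $\overline f$ in $\mathcal{PT}_A$. All quantities are cardinals, possibly infinite. $S(\kappa,\mu)$ is the number of equivalence relations with exactly $\mu$ classes on a set of size $\kappa$ ($0$ if $\kappa<\mu$); $\mu!$ is the size of the symmetric group $\mathcal S_\mu$ on a set of size $\mu$; the empty product is $1$. An $r\times l$ rectangular group over a group $G$ is a semigroup isomorphic to the direct product of $G$ with an $r\times l$ rectangular band (i.e. $U\times V$, $|U|=r$, $|V|=l$, with $(u,v)(u',v')=(u,v')$). *)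

theory Defs
  imports Main "HOL-Algebra.Bij"
begin

unbundle cardinal_syntax

text \<open>
  Partial functions are maps \<open>'x \<rightharpoonup> 'y\<close>, with \<open>im f = ran f\<close> and \<open>y f\<inverse> = {x. f x = Some y}\<close>.
  Cardinals are the cardinal orders of the library; an equality of cardinals is \<open>=o\<close>, so that
  sets of different types can be compared.
\<close>

section \<open>Semigroups given by a carrier set and an operation\<close>

definition semigroup_on :: "'s set \<Rightarrow> ('s \<Rightarrow> 's \<Rightarrow> 's) \<Rightarrow> bool" where
  "semigroup_on S m \<longleftrightarrow>
     (\<forall>x\<in>S. \<forall>y\<in>S. m x y \<in> S) \<and> (\<forall>x\<in>S. \<forall>y\<in>S. \<forall>z\<in>S. m (m x y) z = m x (m y z))"

definition semigroup_iso ::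
  "'s set \<Rightarrow> ('s \<Rightarrow> 's \<Rightarrow> 's) \<Rightarrow> 't set \<Rightarrow> ('t \<Rightarrow> 't \<Rightarrow> 't) \<Rightarrow> bool" where
  "semigroup_iso S m T n \<longleftrightarrow> semigroup_on S m \<and> semigroup_on T n \<and>
     (\<exists>h. bij_betw h S T \<and> (\<forall>x\<in>S. \<forall>y\<in>S. h (m x y) = n (h x) (h y)))"

definition regular_elements :: "'s set \<Rightarrow> ('s \<Rightarrow> 's \<Rightarrow> 's) \<Rightarrow> 's set" where
  "regular_elements S m = {x \<in> S. \<exists>y\<in>S. m (m x y) x = x}"

text \<open>\<open>insert x\<close> accounts for the adjoined identity: these are the ideals \<open>x S\<^sup>1\<close> and \<open>S\<^sup>1 x\<close>.\<close>

definition right_ideal :: "'s set \<Rightarrow> ('s \<Rightarrow> 's \<Rightarrow> 's) \<Rightarrow> 's \<Rightarrow> 's set" where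
  "right_ideal S m x = insert x {m x s |s. s \<in> S}"

definition left_ideal :: "'s set \<Rightarrow> ('s \<Rightarrow> 's \<Rightarrow> 's) \<Rightarrow> 's \<Rightarrow> 's set" where
  "left_ideal S m x = insert x {m s x |s. s \<in> S}"

definition greenR :: "'s set \<Rightarrow> ('s \<Rightarrow> 's \<Rightarrow> 's) \<Rightarrow> 's rel" where
  "greenR S m = {(x, y). x \<in> S \<and> y \<in> S \<and> right_ideal S m x = right_ideal S m y}"

definition greenL :: "'s set \<Rightarrow> ('s \<Rightarrow> 's \<Rightarrow> 's) \<Rightarrow> 's rel" where
  "greenL S m = {(x, y). x \<in> S \<and> y \<in> S \<and> left_ideal S m x = left_ideal S m y}"

definition greenH :: "'s set \<Rightarrow> ('s \<Rightarrow> 's \<Rightarrow> 's) \<Rightarrow> 's rel" where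
  "greenH S m = greenR S m \<inter> greenL S m"

text \<open>The join of the equivalence relations \<open>\<R>\<close> and \<open>\<L>\<close>.\<close>

definition greenD :: "'s set \<Rightarrow> ('s \<Rightarrow> 's \<Rightarrow> 's) \<Rightarrow> 's rel" where
  "greenD S m = (greenR S m \<union> greenL S m)\<^sup>+"

definition is_group_on :: "'s set \<Rightarrow> ('s \<Rightarrow> 's \<Rightarrow> 's) \<Rightarrow> bool" where
  "is_group_on K m \<longleftrightarrow> (\<exists>e. group \<lparr>carrier = K, mult = m, one = e\<rparr>)"

definition is_group_iso_to :: "'s set \<Rightarrow> ('s \<Rightarrow> 's \<Rightarrow> 's) \<Rightarrow> ('g, 'z) monoid_scheme \<Rightarrow> bool" where
  "is_group_iso_to K m G \<longleftrightarrow>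
     (\<exists>e. group \<lparr>carrier = K, mult = m, one = e\<rparr> \<and> \<lparr>carrier = K, mult = m, one = e\<rparr> \<cong> G)"

text \<open>
  \<open>Field r\<close> and \<open>Field l\<close> serve as the sets of sizes \<open>r\<close> and \<open>l\<close> on which the rectangular
  band lives.
\<close>

definition rectangular_group ::
  "'s set \<Rightarrow> ('s \<Rightarrow> 's \<Rightarrow> 's) \<Rightarrow> 'u rel \<Rightarrow> 'v rel \<Rightarrow> ('g, 'z) monoid_scheme \<Rightarrow> bool" where
  "rectangular_group K m r l G \<longleftrightarrow> group G \<and>
     semigroup_iso K m (carrier G \<times> (Field r \<times> Field l))
       (\<lambda>(g, (u, v)) (g', (u', v')). (g \<otimes>\<^bsub>G\<^esub> g', (u, v')))"

text \<open>When \<open>E\<close> is an equivalence relation on \<open>S\<close>, the set \<open>C\<close> is determined by \<open>B\<close>.\<close>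

definition union_of_classes :: "'s set \<Rightarrow> 'c rel \<Rightarrow> 's rel \<Rightarrow> 's set \<Rightarrow> bool" where
  "union_of_classes S \<kappa> E B \<longleftrightarrow> (\<exists>C \<subseteq> S // E. \<Union>C = B \<and> |C| =o \<kappa>)"

section \<open>Cardinals\<close>

definition card_Prod :: "'i set \<Rightarrow> ('i \<Rightarrow> 'k rel) \<Rightarrow> ('i \<Rightarrow> 'k) rel" where
  "card_Prod K \<kappa> = |Pi\<^sub>E K (\<lambda>k. Field (\<kappa> k))|"

definition card_Stirling :: "'k rel \<Rightarrow> 'm rel \<Rightarrow> ('k rel) rel" where
  "card_Stirling \<kappa> \<mu> = |{E. equiv (Field \<kappa>) E \<and> |Field \<kappa> // E| =o \<mu>}|"

definition symmetric_group :: "'m rel \<Rightarrow> ('m \<Rightarrow> 'm) monoid" where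
  "symmetric_group \<mu> = BijGroup (Field \<mu>)"

definition card_fact :: "'m rel \<Rightarrow> ('m \<Rightarrow> 'm) rel" where
  "card_fact \<mu> = |carrier (symmetric_group \<mu>)|"

section \<open>Partial functions and the sandwich semigroup\<close>

definition PT :: "'x set \<Rightarrow> 'y set \<Rightarrow> ('x \<rightharpoonup> 'y) set" where
  "PT X Y = {f. dom f \<subseteq> X \<and> ran f \<subseteq> Y}"

text \<open>Composition from left to right: first \<open>f\<close>, then \<open>g\<close>.\<close>

definition pcomp :: "('x \<rightharpoonup> 'y) \<Rightarrow> ('y \<rightharpoonup> 'z) \<Rightarrow> ('x \<rightharpoonup> 'z)" where
  "pcomp f g = g \<circ>\<^sub>m f"

definition prank :: "('x \<rightharpoonup> 'y) \<Rightarrow> 'y rel" where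
  "prank f = |ran f|"

definition sandwich :: "('y \<rightharpoonup> 'x) \<Rightarrow> ('x \<rightharpoonup> 'y) \<Rightarrow> ('x \<rightharpoonup> 'y) \<Rightarrow> ('x \<rightharpoonup> 'y)" where
  "sandwich a f g = pcomp (pcomp f a) g"

definition RegPT :: "'x set \<Rightarrow> 'y set \<Rightarrow> ('y \<rightharpoonup> 'x) \<Rightarrow> ('x \<rightharpoonup> 'y) set" where
  "RegPT X Y a = regular_elements (PT X Y) (sandwich a)"

definition bar :: "('y \<rightharpoonup> 'x) \<Rightarrow> ('x \<rightharpoonup> 'y) \<Rightarrow> ('x \<rightharpoonup> 'x)" where
  "bar a f = pcomp f a |` ran a"

text \<open>The pullback to \<open>P\<close>, along \<open>f \<mapsto> bar a f\<close>, of a relation \<open>E\<close> on the partial transformations.\<close>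

definition hat :: "('x \<rightharpoonup> 'y) set \<Rightarrow> ('y \<rightharpoonup> 'x) \<Rightarrow> ('x \<rightharpoonup> 'x) rel \<Rightarrow> ('x \<rightharpoonup> 'y) rel" where
  "hat P a E = {(f, g). f \<in> P \<and> g \<in> P \<and> (bar a f, bar a g) \<in> E}"

text \<open>The two-row notation for \<open>f\<close>, with upper row \<open>F\<close> and lower row \<open>y\<close> indexed by \<open>J\<close>.\<close>

definition tabular :: "('x \<rightharpoonup> 'y) \<Rightarrow> 'j set \<Rightarrow> ('j \<Rightarrow> 'x set) \<Rightarrow> ('j \<Rightarrow> 'y) \<Rightarrow> bool" where
  "tabular f J F y \<longleftrightarrow> dom f = (\<Union>j\<in>J. F j) \<and> ran f = y ` J \<and> inj_on y J \<and>
     (\<forall>j\<in>J. F j = {x. f x = Some (y j)})"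

end

theory Submission
  imports Defs
begin

text \<open>
  An element \<open>f\<close> of \<open>PT X Y\<close> is regular iff \<open>ran f \<subseteq> dom a\<close>, \<open>a\<close> is injective on \<open>ran f\<close> and
  every value of \<open>f\<close> is attained on \<open>A = ran a\<close>. Between regular elements, \<open>\<R>\<close> is equality of
  kernels, \<open>\<L>\<close> equality of images and \<open>\<D>\<close> equality of ranks; \<open>PT A A\<close> is itself the sandwich
  semigroup with \<open>X = Y = A\<close> and \<open>a\<close> the identity. Up to \<open>\<R>\<close>, an element of the \<open>\<R>\<close>-hat class
  of \<open>f\<close> may be taken to agree with \<open>f\<close> on \<open>A\<close>, and then it is an arbitrary map from \<open>X - A\<close> to
  \<open>ran f\<close> with an undefined value added. Up to \<open>\<L>\<close>, an element of the \<open>\<L>\<close>-hat class is a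
  transversal of the fibres of \<open>a\<close> that meet \<open>ran f\<close>. Adding a permutation \<open>s\<close> of \<open>ran f\<close> gives
  coordinates \<open>(s, n, Z)\<close> on the \<open>\<H>\<close>-hat class. If the \<open>\<H>\<close>-class below is a group, then \<open>a f\<close>
  restricts to a permutation \<open>\<phi>\<close> of \<open>ran f\<close>, the product is \<open>(s, n, Z) (s', n', Z') = (s \<phi> s', n, Z')\<close>,
  and \<open>s \<mapsto> s \<phi>\<close> straightens it into a rectangular group.
\<close>

section \<open>Cardinalities of images and quotients\<close>

text \<open>\<open>k\<close> and \<open>l\<close> induce the same partition of \<open>S\<close>, so
  applying \<open>l\<close> to any chosen preimage of a value of \<open>k\<close> is well defined
  and injective. The codomains may differ, so classes can be compared with invariants.\<close>

lemma card_of_image_cong: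
  assumes "\<And>x y. x \<in> S \<Longrightarrow> y \<in> S \<Longrightarrow> k x = k y \<longleftrightarrow> l x = l y"
  shows "|k ` S| =o |l ` S|"
proof -
  have *: "l (inv_into S k (k x)) = l x" if "x \<in> S" for x
    using assms[of "inv_into S k (k x)" x] that by (simp add: inv_into_into f_inv_into_f)
  have "bij_betw (\<lambda>c. l (inv_into S k c)) (k ` S) (l ` S)"
    unfolding bij_betw_def
  proof
    show "inj_on (\<lambda>c. l (inv_into S k c)) (k ` S)"
      by (rule inj_onI) (use * assms in auto)
    show "(\<lambda>c. l (inv_into S k c)) ` k ` S = l ` S"
      unfolding image_image using * by (rule image_cong[OF refl])
  qed
  then show ?thesis by (rule card_of_ordIsoI)
qed

lemma card_of_quotient_kernel:
  "|S // {(x, y). x \<in> S \<and> y \<in> S \<and> k x = k y}| =o |k ` S|"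
proof -
  let ?E = "{(x, y). x \<in> S \<and> y \<in> S \<and> k x = k y}"
  have "S // ?E = (\<lambda>x. ?E `` {x}) ` S"
    by (auto simp: quotient_def)
  moreover have "|(\<lambda>x. ?E `` {x}) ` S| =o |k ` S|"
    by (rule card_of_image_cong) auto
  ultimately show ?thesis by simp
qed

text \<open>\<R>, \<L> and \<H> on \<open>P\<close> are the kernels of \<open>pker\<close>,
  \<open>ran\<close> and the pair of both, so each count of classes reduces to the cardinality of an
  image.\<close>

lemma union_of_classes_kernel:
  assumes E: "E = {(x, y). x \<in> S \<and> y \<in> S \<and> k x = k y}"
    and "B \<subseteq> S"
    and saturated: "\<And>x y. x \<in> B \<Longrightarrow> y \<in> S \<Longrightarrow> k x = k y \<Longrightarrow> y \<in> B"
    and "|k ` B| =o \<kappa>"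
  shows "union_of_classes S \<kappa> E B"
  unfolding union_of_classes_def
proof (intro exI conjI)
  show "(\<lambda>x. E `` {x}) ` B \<subseteq> S // E"
    using \<open>B \<subseteq> S\<close> by (auto simp: quotient_def)
  show "\<Union> ((\<lambda>x. E `` {x}) ` B) = B"
    using \<open>B \<subseteq> S\<close> saturated by (auto simp: E)
  have "|(\<lambda>x. E `` {x}) ` B| =o |k ` B|"
    by (rule card_of_image_cong) (use \<open>B \<subseteq> S\<close> in \<open>auto simp: E\<close>)
  then show "|(\<lambda>x. E `` {x}) ` B| =o \<kappa>"
    using \<open>|k ` B| =o \<kappa>\<close> ordIso_transitive by blast
qed

lemma card_of_const_fibres:
  assumes "Card_order \<kappa>"
    and "\<And>b. b \<in> q ` S \<Longrightarrow> |{s \<in> S. q s = b}| =o \<kappa>"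
  shows "|S| =o \<kappa> *c |q ` S|"
proof -
  let ?F = "SIGMA b : q ` S. {s \<in> S. q s = b}"
  have "bij_betw snd ?F S"
    by (auto simp: bij_betw_def inj_on_def image_iff)
  then have "|S| =o |?F|"
    by (meson card_of_ordIsoI ordIso_symmetric)
  also have "|?F| =o |q ` S \<times> Field \<kappa>|"
  proof -
    have "|{s \<in> S. q s = b}| =o |Field \<kappa>|" if "b \<in> q ` S" for b
      using assms(2)[OF that] card_of_Field_ordIso[OF assms(1)] ordIso_symmetric ordIso_transitive
      by blast
    then show ?thesis
      by (simp add: ordIso_iff_ordLeq card_of_Sigma_mono1)
  qed
  also have "|q ` S \<times> Field \<kappa>| =o |Field \<kappa> \<times> q ` S|"
    by (rule card_of_Times_commute)
  also have "|Field \<kappa> \<times> q ` S| =o \<kappa> *c |q ` S|"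
    by (simp add: cprod_def Field_card_of card_of_refl)
  finally show ?thesis .
qed

text \<open>The preimage \<open>b'\<close> of \<open>c\<close> takes over the value of
  \<open>b\<close>; if \<open>b' = b\<close>, the update changes nothing.\<close>

lemma bij_betw_remove:
  assumes "bij_betw h B C" "b \<in> B" "c \<in> C"
  shows "\<exists>h'. bij_betw h' (B - {b}) (C - {c})"
proof -
  obtain b' where b': "b' \<in> B" "h b' = c"
    using assms by (auto simp: bij_betw_def)
  have "bij_betw (h(b' := h b)) (B - {b}) (C - {c})"
  proof (rule bij_betw_imageI)
    show "inj_on (h(b' := h b)) (B - {b})"
      using assms b' by (auto simp: bij_betw_def inj_on_def)
    show "(h(b' := h b)) ` (B - {b}) = C - {c}"
      using assms b' unfolding bij_betw_def inj_on_def
      by (auto simp: image_iff split: if_splits)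
  qed
  then show ?thesis by blast
qed

section \<open>Green's relations and groups on a carrier set\<close>

text \<open>For operations that agree only on the carrier, such as \<open>pcomp\<close> and the
  sandwich product by the identity on \<open>A\<close>.\<close>

lemma green_cong:
  assumes "\<And>x y. x \<in> S \<Longrightarrow> y \<in> S \<Longrightarrow> m x y = n x y"
  shows "greenR S m = greenR S n" "greenL S m = greenL S n"
    "greenH S m = greenH S n" "greenD S m = greenD S n"
proof -
  have "{m x s |s. s \<in> S} = {n x s |s. s \<in> S}" "{m s x |s. s \<in> S} = {n s x |s. s \<in> S}"
    if "x \<in> S" for x
    by (rule Collect_cong, use assms that in metis)+
  then have "right_ideal S m x = right_ideal S n x" "left_ideal S m x = left_ideal S n x"
    if "x \<in> S" for x
    using that by (simp_all add: right_ideal_def left_ideal_def)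
  then show "greenR S m = greenR S n" "greenL S m = greenL S n"
    by (auto simp: greenR_def greenL_def)
  then show "greenH S m = greenH S n" "greenD S m = greenD S n"
    by (simp_all add: greenH_def greenD_def)
qed

lemma is_group_on_cong:
  assumes "is_group_on K m" "\<And>x y. x \<in> K \<Longrightarrow> y \<in> K \<Longrightarrow> m x y = n x y"
  shows "is_group_on K n"
proof -
  obtain e where e: "group \<lparr>carrier = K, mult = m, one = e\<rparr>"
    using assms(1) by (auto simp: is_group_on_def)
  then interpret G: group "\<lparr>carrier = K, mult = m, one = e\<rparr>" .
  let ?K = "\<lparr>carrier = K, mult = n, one = e\<rparr>"
  have K: "m x y \<in> K" if "x \<in> K" "y \<in> K" for x y
    using G.m_closed[of x y] that by simp
  have "group ?K"
  proof (rule groupI)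
    fix x y z assume "x \<in> carrier ?K" "y \<in> carrier ?K" "z \<in> carrier ?K"
    then show "x \<otimes>\<^bsub>?K\<^esub> y \<otimes>\<^bsub>?K\<^esub> z = x \<otimes>\<^bsub>?K\<^esub> (y \<otimes>\<^bsub>?K\<^esub> z)"
      using G.m_assoc[of x y z] K by (simp flip: assms(2))
  next
    fix x y assume "x \<in> carrier ?K" "y \<in> carrier ?K"
    then show "x \<otimes>\<^bsub>?K\<^esub> y \<in> carrier ?K"
      using K by (simp flip: assms(2))
  next
    show "\<one>\<^bsub>?K\<^esub> \<in> carrier ?K"
      using G.one_closed by simp
    fix x assume x: "x \<in> carrier ?K"
    then show "\<one>\<^bsub>?K\<^esub> \<otimes>\<^bsub>?K\<^esub> x = x"
      using G.l_one[of x] G.one_closed by (simp flip: assms(2))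
    show "\<exists>y\<in>carrier ?K. y \<otimes>\<^bsub>?K\<^esub> x = \<one>\<^bsub>?K\<^esub>"
      using G.l_inv_ex[of x] x by (auto simp flip: assms(2))
  qed
  then show ?thesis
    by (auto simp: is_group_on_def)
qed

lemma is_group_on_idempotent:
  assumes "is_group_on K m"
  shows "\<exists>e\<in>K. m e e = e"
proof -
  obtain e where e: "group \<lparr>carrier = K, mult = m, one = e\<rparr>"
    using assms by (auto simp: is_group_on_def)
  then interpret G: group "\<lparr>carrier = K, mult = m, one = e\<rparr>" .
  show ?thesis using G.one_closed G.l_one[of e] by auto
qed

text \<open>Transport of structure: closure keeps both sides of each law in \<open>K\<close>, and
  the injective homomorphism \<open>h\<close> lets the law be checked in \<open>G\<close>. Identity
  and inverses are preimages under \<open>h\<close>.\<close>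

lemma is_group_iso_toI:
  assumes G: "group G" and h: "bij_betw h K (carrier G)"
    and closed: "\<And>x y. x \<in> K \<Longrightarrow> y \<in> K \<Longrightarrow> m x y \<in> K"
    and hom: "\<And>x y. x \<in> K \<Longrightarrow> y \<in> K \<Longrightarrow> h (m x y) = h x \<otimes>\<^bsub>G\<^esub> h y"
  shows "is_group_iso_to K m G"
proof -
  interpret G: group G by fact
  define e where "e = inv_into K h \<one>\<^bsub>G\<^esub>"
  let ?K = "\<lparr>carrier = K, mult = m, one = e\<rparr>"
  have surj: "h ` K = carrier G" and inj: "inj_on h K"
    using h by (auto simp: bij_betw_def)
  have e: "e \<in> K" "h e = \<one>\<^bsub>G\<^esub>"
    using surj by (auto simp: e_def inv_into_into f_inv_into_f)
  have hK: "h x \<in> carrier G" if "x \<in> K" for x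
    using surj that by blast
  have "group ?K"
  proof (rule groupI)
    fix x y z assume "x \<in> carrier ?K" "y \<in> carrier ?K" "z \<in> carrier ?K"
    then show "x \<otimes>\<^bsub>?K\<^esub> y \<otimes>\<^bsub>?K\<^esub> z = x \<otimes>\<^bsub>?K\<^esub> (y \<otimes>\<^bsub>?K\<^esub> z)"
      by (auto intro!: inj_onD[OF inj] simp: closed hom hK G.m_assoc)
  next
    fix x assume x: "x \<in> carrier ?K"
    then show "\<one>\<^bsub>?K\<^esub> \<otimes>\<^bsub>?K\<^esub> x = x"
      by (auto intro!: inj_onD[OF inj] simp: closed hom hK e)
    obtain y where "y \<in> K" "h y = inv\<^bsub>G\<^esub> h x"
      using surj hK x G.inv_closed by (metis image_iff partial_object.select_convs(1))
    with x show "\<exists>y\<in>carrier ?K. y \<otimes>\<^bsub>?K\<^esub> x = \<one>\<^bsub>?K\<^esub>"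
      by (intro bexI[of _ y]) (auto intro!: inj_onD[OF inj] simp: closed hom hK e)
  qed (simp_all add: e closed)
  moreover have "h \<in> iso ?K G"
    using h hK by (auto simp: iso_def hom_def hom)
  ultimately show ?thesis
    by (auto simp: is_group_iso_to_def is_iso_def)
qed

text \<open>Bijections \<open>p\<close> and \<open>q\<close> onto the fields of \<open>r\<close> and
  \<open>l\<close> rename the two band coordinates, which the product merely selects.\<close>

lemma rectangular_groupI:
  assumes G: "group G"
    and c: "bij_betw (\<lambda>x. (g x, (u x, v x))) K (carrier G \<times> (U \<times> V))"
    and U: "|U| =o r" "Card_order r" and V: "|V| =o l" "Card_order l"
    and sg: "semigroup_on K m"
    and hom: "\<And>x y. x \<in> K \<Longrightarrow> y \<in> K \<Longrightarrow> g (m x y) = g x \<otimes>\<^bsub>G\<^esub> g y"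
    and uv: "\<And>x y. x \<in> K \<Longrightarrow> y \<in> K \<Longrightarrow> u (m x y) = u x"
      "\<And>x y. x \<in> K \<Longrightarrow> y \<in> K \<Longrightarrow> v (m x y) = v y"
  shows "rectangular_group K m r l G"
proof -
  interpret G: group G by fact
  have "|U| =o |Field r|" "|V| =o |Field l|"
    using U V card_of_Field_ordIso ordIso_symmetric ordIso_transitive by blast+
  then obtain p q where pq: "bij_betw p U (Field r)" "bij_betw q V (Field l)"
    by (auto simp: card_of_ordIso[symmetric])
  have "bij_betw (map_prod id (map_prod p q)) (carrier G \<times> (U \<times> V)) (carrier G \<times> (Field r \<times> Field l))"
    by (intro bij_betw_map_prod pq bij_betw_id)
  from bij_betw_trans[OF c this]
  have "bij_betw (\<lambda>x. (g x, (p (u x), q (v x)))) K (carrier G \<times> (Field r \<times> Field l))"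
    by (simp add: o_def)
  moreover have "semigroup_on (carrier G \<times> (Field r \<times> Field l))
       (\<lambda>(g, (u, v)) (g', (u', v')). (g \<otimes>\<^bsub>G\<^esub> g', (u, v')))"
    by (auto simp: semigroup_on_def G.m_assoc)
  ultimately show ?thesis
    unfolding rectangular_group_def semigroup_iso_def
    using G sg hom uv by (intro conjI exI[of _ "\<lambda>x. (g x, (p (u x), q (v x)))"]) auto
qed

section \<open>Partial functions and their kernels\<close>

text \<open>A partial equivalence relation that records the domain as its field.\<close>

definition pker :: "('x \<rightharpoonup> 'y) \<Rightarrow> 'x rel" where
  "pker f = {(x, x'). \<exists>y. f x = Some y \<and> f x' = Some y}"

lemma pker_eqI:
  assumes "dom f = dom g" "\<And>x x'. x \<in> dom f \<Longrightarrow> x' \<in> dom f \<Longrightarrow> f x = f x' \<longleftrightarrow> g x = g x'"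
  shows "pker f = pker g"
proof -
  have "(x, x') \<in> pker f \<longleftrightarrow> x \<in> dom f \<and> x' \<in> dom f \<and> f x = f x'" for x x' and f :: "'u \<rightharpoonup> 'v"
    by (auto simp: pker_def)
  with assms show ?thesis by (metis subrelI subset_antisym)
qed

lemma dom_eq_Domain_pker: "dom f = Domain (pker f)"
  by (auto simp: pker_def)

lemma pker_eq_dom: "pker f = pker g \<Longrightarrow> dom f = dom g"
  by (simp add: dom_eq_Domain_pker)

text \<open>The hypothesis also allows \<open>f x = f x' = None\<close>, which no pair in
  \<open>pker f\<close> witnesses; there the equality of the domains decides.\<close>

lemma pker_eqD:
  assumes "pker f = pker g" "f x = f x'"
  shows "g x = g x'"
proof (cases "f x")
  case None
  with assms pker_eq_dom[OF assms(1)] show ?thesis by (metis domIff)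
next
  case (Some y)
  then have "(x, x') \<in> pker f"
    using assms(2) by (auto simp: pker_def)
  then have "(x, x') \<in> pker g"
    using assms by simp
  then show ?thesis
    by (auto simp only: pker_def)
qed

lemma pker_restrict: "pker (f |` S) = pker f \<inter> S \<times> S"
  by (auto simp: pker_def restrict_map_def split: if_splits)

lemma pker_map_option: "inj_on \<sigma> (ran f) \<Longrightarrow> pker (map_option \<sigma> \<circ> f) = pker f"
  by (rule pker_eqI) (auto simp: ranI inj_on_eq_iff)

lemma ran_map_option_comp: "ran (map_option \<sigma> \<circ> f) = \<sigma> ` ran f"
  by (auto simp: ran_def)

text \<open>\<open>\<sigma>\<close> sends a value of \<open>f\<close> to the value of
  \<open>g\<close> at any point of the same kernel class; equal kernels make this well defined and
  injective. Later comparisons of elements with equal kernels start from it.\<close>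

lemma pker_eq_relabel:
  assumes "pker f = pker g"
  shows "\<exists>\<sigma>. bij_betw \<sigma> (ran f) (ran g) \<and> g = map_option \<sigma> \<circ> f"
proof -
  define \<sigma> where "\<sigma> = (\<lambda>y. the (g (SOME x. f x = Some y)))"
  have g: "g x = map_option \<sigma> (f x)" for x
  proof (cases "f x")
    case None
    then show ?thesis using pker_eq_dom[OF assms] by auto
  next
    case (Some y)
    then have "f (SOME x. f x = Some y) = Some y" by (rule someI)
    then have "g (SOME x. f x = Some y) = g x"
      using Some assms by (intro pker_eqD[of f g]) auto
    moreover have "x \<in> dom g" using Some pker_eq_dom[OF assms] by auto
    ultimately show ?thesis using Some by (auto simp: \<sigma>_def)
  qed
  have "inj_on \<sigma> (ran f)"
  proof (rule inj_onI)
    fix y y' assume "y \<in> ran f" "y' \<in> ran f" and eq: "\<sigma> y = \<sigma> y'"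
    then obtain x x' where x: "f x = Some y" "f x' = Some y'" by (auto simp: ran_def)
    then have "g x = g x'" by (simp add: g eq)
    then have "f x = f x'" by (rule pker_eqD[OF assms[symmetric]])
    with x show "y = y'" by simp
  qed
  moreover have "g = map_option \<sigma> \<circ> f" using g by auto
  ultimately show ?thesis by (auto simp: bij_betw_def ran_map_option_comp)
qed

lemma pker_eq_card_ran: "pker f = pker g \<Longrightarrow> |ran f| =o |ran g|"
  by (drule pker_eq_relabel) (elim exE conjE, erule card_of_ordIsoI)

section \<open>Pointwise description of the compositions and of \<open>bar\<close>\<close>

lemma pcomp_Some_iff: "pcomp f g x = Some z \<longleftrightarrow> (\<exists>y. f x = Some y \<and> g y = Some z)"
  by (simp add: pcomp_def map_comp_Some_iff)

lemma sandwich_Some_iff: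
  "sandwich a f g x = Some z \<longleftrightarrow> (\<exists>y w. f x = Some y \<and> a y = Some w \<and> g w = Some z)"
  by (auto simp: sandwich_def pcomp_Some_iff)

lemma map_eqI:
  assumes "\<And>x z. f x = Some z \<longleftrightarrow> g x = Some z"
  shows "f = g"
proof
  show "f x = g x" for x
    using assms[of x "the (f x)"] assms[of x "the (g x)"] by (cases "f x"; cases "g x") simp_all
qed

lemma sandwich_assoc: "sandwich a (sandwich a f g) h = sandwich a f (sandwich a g h)"
  by (rule map_eqI) (auto simp: sandwich_Some_iff)

lemma bar_Some_iff:
  "bar a f x = Some z \<longleftrightarrow> x \<in> ran a \<and> (\<exists>y. f x = Some y \<and> a y = Some z)"
  by (simp add: bar_def restrict_map_def pcomp_Some_iff)

text \<open>The values of \<open>bar a f\<close> already lie in \<open>ran a\<close>, so cutting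
  \<open>g\<close> down to \<open>ran a\<close> loses nothing; this is the homomorphism
  property.\<close>

lemma bar_sandwich: "bar a (sandwich a f g) = pcomp (bar a f) (bar a g)"
  by (rule map_eqI, unfold bar_Some_iff pcomp_Some_iff sandwich_Some_iff) (blast intro: ranI)

lemma ran_restrict_iff: "y \<in> ran (f |` S) \<longleftrightarrow> (\<exists>x\<in>S. f x = Some y)"
  by (auto simp: ran_def restrict_map_def)

lemma dom_subset_restrict: "dom f \<subseteq> S \<Longrightarrow> f |` S = f"
  by (rule map_eqI) (auto simp: restrict_map_def)

section \<open>Regular elements and Green's relations of the sandwich semigroup\<close>

locale sandwich_PT =
  fixes X :: "'x set" and Y :: "'y set" and a :: "'y \<rightharpoonup> 'x"
  assumes a_in_PT: "a \<in> PT Y X"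
begin

abbreviation P :: "('x \<rightharpoonup> 'y) set" where
  "P \<equiv> RegPT X Y a"

abbreviation star :: "('x \<rightharpoonup> 'y) \<Rightarrow> ('x \<rightharpoonup> 'y) \<Rightarrow> ('x \<rightharpoonup> 'y)" (infixl "\<star>" 70) where
  "f \<star> g \<equiv> sandwich a f g"

lemma ran_a_subset: "ran a \<subseteq> X" and dom_a_subset: "dom a \<subseteq> Y"
  using a_in_PT by (auto simp: PT_def)

text \<open>As \<open>a\<close> is injective on \<open>ran f\<close>, it can be undone there:
  \<open>s\<close> leads from the images under \<open>a\<close> back to \<open>ran f\<close> and
  then applies \<open>\<sigma>\<close>. Keeping \<open>dom s\<close> inside \<open>ran a\<close>
  makes \<open>s\<close> attain all its values on \<open>ran a\<close>, as regularity
  demands.\<close>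

lemma factor_through_star:
  assumes f: "ran f \<subseteq> dom a" "inj_on a (ran f)"
  shows "\<exists>s. dom s \<subseteq> ran a \<and> ran s = \<sigma> ` ran f \<and> ran (s |` ran a) = ran s \<and>
    f \<star> s = map_option \<sigma> \<circ> f"
proof -
  define s where "s w = (if \<exists>y\<in>ran f. a y = Some w
    then Some (\<sigma> (SOME y. y \<in> ran f \<and> a y = Some w)) else None)" for w
  have s: "s w = Some (\<sigma> y)" if "y \<in> ran f" "a y = Some w" for y w
  proof -
    have "(SOME y. y \<in> ran f \<and> a y = Some w) = y"
      using that by (intro some_equality) (auto intro: inj_onD[OF f(2)])
    then show ?thesis using that by (auto simp: s_def)
  qed
  have s': "\<exists>y\<in>ran f. a y = Some w \<and> z = \<sigma> y" if "s w = Some z" for w z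
  proof -
    from that obtain y where "y \<in> ran f" "a y = Some w"
      by (auto simp: s_def split: if_splits)
    with s[OF this] that show ?thesis by auto
  qed
  have fa: "\<exists>w. a y = Some w" if "y \<in> ran f" for y
    using f(1) that by auto
  have dom: "dom s \<subseteq> ran a"
    using s' by (fastforce intro: ranI)
  moreover have "ran s = \<sigma> ` ran f"
  proof
    show "ran s \<subseteq> \<sigma> ` ran f"
      using s' by (force simp: ran_def)
    show "\<sigma> ` ran f \<subseteq> ran s"
      using s fa by (metis image_subsetI ranI)
  qed
  moreover have "s |` ran a = s"
    using dom by (rule dom_subset_restrict)
  moreover have "f \<star> s = map_option \<sigma> \<circ> f"
  proof (rule map_eqI)
    fix x z
    show "(f \<star> s) x = Some z \<longleftrightarrow> (map_option \<sigma> \<circ> f) x = Some z"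
    proof
      assume "(f \<star> s) x = Some z"
      then obtain y w where "f x = Some y" "a y = Some w" "s w = Some z"
        by (auto simp: sandwich_Some_iff)
      with s[of y w] show "(map_option \<sigma> \<circ> f) x = Some z"
        by (auto intro: ranI)
    next
      assume "(map_option \<sigma> \<circ> f) x = Some z"
      then obtain y where y: "f x = Some y" "z = \<sigma> y" by auto
      with fa[of y] obtain w where "a y = Some w" by (auto intro: ranI)
      with y s[of y w] show "(f \<star> s) x = Some z"
        by (auto simp: sandwich_Some_iff intro: ranI)
    qed
  qed
  ultimately show ?thesis by metis
qed

text \<open>\<open>\<sigma>\<close> is a section of \<open>a\<close> followed by \<open>f\<close>:
  each value \<open>y\<close> of \<open>f\<close> is attained at some \<open>w\<close> in
  \<open>ran a\<close>, and \<open>\<sigma> y\<close> is a point that \<open>a\<close> sends to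
  \<open>w\<close>.\<close>

lemma ex_section:
  assumes "ran (f |` ran a) = ran f"
  shows "\<exists>\<sigma>. \<forall>y\<in>ran f. \<exists>w. a (\<sigma> y) = Some w \<and> f w = Some y"
proof (rule bchoice, rule ballI)
  fix y assume "y \<in> ran f"
  then have "y \<in> ran (f |` ran a)" by (simp add: assms)
  then obtain w where "w \<in> ran a" "f w = Some y"
    by (auto simp: ran_restrict_iff)
  then show "\<exists>z w. a z = Some w \<and> f w = Some y"
    by (auto simp: ran_def)
qed

text \<open>If \<open>f \<star> g \<star> f = f\<close>, a value \<open>y\<close> runs through
  \<open>a\<close>, \<open>g\<close>, \<open>a\<close>, \<open>f\<close> back to itself: so
  \<open>a y\<close> is defined and determines \<open>y\<close>, and \<open>y\<close> is attained at
  a point of \<open>ran a\<close>. Conversely, \<open>f\<close> followed by a section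
  \<open>\<sigma>\<close> is some \<open>f \<star> s\<close>, and \<open>a\<close> and
  \<open>f\<close> then lead back to \<open>f\<close>.\<close>

lemma P_iff:
  "f \<in> P \<longleftrightarrow> dom f \<subseteq> X \<and> ran f \<subseteq> dom a \<and> inj_on a (ran f) \<and> ran (f |` ran a) = ran f"
  (is "_ \<longleftrightarrow> ?R")
proof
  assume "f \<in> P"
  then obtain g where f: "f \<in> PT X Y" and g: "f \<star> g \<star> f = f"
    by (auto simp: RegPT_def regular_elements_def)
  have *: "\<exists>w z v. a y = Some w \<and> g w = Some z \<and> a z = Some v \<and> f v = Some y" if "y \<in> ran f" for y
  proof -
    from that obtain x where x: "f x = Some y" by (auto simp: ran_def)
    then have "(f \<star> g \<star> f) x = Some y" by (simp add: g)
    with x show ?thesis by (auto simp: sandwich_Some_iff)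
  qed
  have "y \<in> ran (f |` ran a)" if y: "y \<in> ran f" for y
  proof -
    from *[OF y] obtain z v where "a z = Some v" "f v = Some y" by auto
    then show ?thesis by (auto simp: ran_restrict_iff intro: ranI)
  qed
  moreover have "ran (f |` ran a) \<subseteq> ran f"
    by (auto simp: ran_restrict_iff intro: ranI)
  ultimately have "ran (f |` ran a) = ran f" by blast
  moreover have "inj_on a (ran f)"
  proof (rule inj_onI)
    fix y y' assume "y \<in> ran f" "y' \<in> ran f" "a y = a y'"
    with *[of y] *[of y'] show "y = y'" by force
  qed
  moreover have "ran f \<subseteq> dom a"
    using * by blast
  ultimately show ?R
    using f by (simp add: PT_def)
next
  assume R: ?R
  then have f: "f \<in> PT X Y"
    using dom_a_subset by (auto simp: PT_def)
  obtain \<sigma> where \<sigma>: "\<exists>w. a (\<sigma> y) = Some w \<and> f w = Some y" if "y \<in> ran f" for y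
    using ex_section[of f] R by auto
  obtain s where s: "dom s \<subseteq> ran a" "ran s = \<sigma> ` ran f" "f \<star> s = map_option \<sigma> \<circ> f"
    using factor_through_star[of f \<sigma>] R by auto
  have "f \<star> s \<star> f = f"
  proof (rule map_eqI)
    fix x z
    show "(f \<star> s \<star> f) x = Some z \<longleftrightarrow> f x = Some z"
      using \<sigma>[OF ranI] by (auto simp: sandwich_Some_iff s(3)) force+
  qed
  moreover have "s \<in> PT X Y"
    using s \<sigma> ran_a_subset dom_a_subset by (auto simp: PT_def) blast
  ultimately show "f \<in> P"
    using f by (auto simp: RegPT_def regular_elements_def)
qed

text \<open>A value of the product is \<open>g w\<close>, where \<open>w\<close> is the image under
  \<open>a\<close> of a value \<open>y\<close> of \<open>f\<close>. As \<open>f\<close> attains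
  \<open>y\<close> already on \<open>ran a\<close>, the product attains its value there too.\<close>

lemma P_closed: "f \<in> P \<Longrightarrow> g \<in> P \<Longrightarrow> f \<star> g \<in> P"
proof -
  assume f: "f \<in> P" and g: "g \<in> P"
  have sub: "ran (f \<star> g) \<subseteq> ran g" "dom (f \<star> g) \<subseteq> dom f"
    by (auto simp: ran_def sandwich_Some_iff)
  have "z \<in> ran ((f \<star> g) |` ran a)" if z: "z \<in> ran (f \<star> g)" for z
  proof -
    from z obtain x y w where y: "f x = Some y" "a y = Some w" "g w = Some z"
      by (auto simp: ran_def sandwich_Some_iff)
    then have "y \<in> ran (f |` ran a)" using f by (auto simp: P_iff intro: ranI)
    with y show ?thesis by (auto simp: ran_restrict_iff sandwich_Some_iff)
  qed
  moreover have "ran ((f \<star> g) |` ran a) \<subseteq> ran (f \<star> g)"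
    by (auto simp: ran_restrict_iff intro: ranI)
  ultimately have "ran ((f \<star> g) |` ran a) = ran (f \<star> g)" by blast
  with f g sub show ?thesis
    unfolding P_iff by (meson inj_on_subset subset_trans)
qed

lemma semigroup_on_P: "B \<subseteq> P \<Longrightarrow> (\<And>f g. f \<in> B \<Longrightarrow> g \<in> B \<Longrightarrow> f \<star> g \<in> B) \<Longrightarrow> semigroup_on B (\<star>)"
  by (simp add: semigroup_on_def sandwich_assoc)

section \<open>Divisibility and Green's relations among the regular elements\<close>

lemma P_relabel:
  assumes "f \<in> P" "inj_on \<sigma> (ran f)" "\<sigma> ` ran f \<subseteq> dom a" "inj_on a (\<sigma> ` ran f)"
  shows "map_option \<sigma> \<circ> f \<in> P"
proof -
  have "(map_option \<sigma> \<circ> f) |` ran a = map_option \<sigma> \<circ> (f |` ran a)"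
    by (auto simp: restrict_map_def)
  moreover have "dom (map_option \<sigma> \<circ> f) = dom f" by auto
  ultimately show ?thesis
    using assms by (simp add: P_iff ran_map_option_comp)
qed

text \<open>The relabelling that turns \<open>f\<close> into \<open>g\<close> is carried out by a
  right factor. That factor has the image of \<open>g\<close> and so inherits the conditions on the
  image in \<open>P_iff\<close>.\<close>

lemma right_factor:
  assumes "f \<in> P" "g \<in> P" "pker f = pker g"
  shows "\<exists>s\<in>P. f \<star> s = g"
proof -
  obtain \<sigma> where \<sigma>: "bij_betw \<sigma> (ran f) (ran g)" "g = map_option \<sigma> \<circ> f"
    using pker_eq_relabel[OF assms(3)] by blast
  have f: "ran f \<subseteq> dom a" "inj_on a (ran f)"
    using assms(1) by (auto simp: P_iff)
  obtain s where "dom s \<subseteq> ran a" "ran s = \<sigma> ` ran f" "ran (s |` ran a) = ran s" "f \<star> s = g"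
    using factor_through_star[OF f, of \<sigma>] \<sigma>(2) by blast
  moreover have "s \<in> P"
    using calculation \<sigma> assms(2) ran_a_subset unfolding P_iff bij_betw_def by (metis subset_trans)
  ultimately show ?thesis by blast
qed

text \<open>The left factor is \<open>g\<close> followed by a section \<open>\<sigma>\<close>, since
  \<open>a\<close> and \<open>f\<close> lead each \<open>\<sigma> y\<close> back to
  \<open>y\<close>. The same cancellation makes \<open>\<sigma>\<close>, and \<open>a\<close> on its
  image, injective, so the factor is regular.\<close>

lemma left_factor:
  assumes f: "f \<in> P" and g: "g \<in> P" and ran: "ran f = ran g"
  shows "\<exists>s\<in>P. s \<star> f = g"
proof -
  obtain \<sigma> where \<sigma>: "\<exists>w. a (\<sigma> y) = Some w \<and> f w = Some y" if "y \<in> ran f" for y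
    using ex_section[of f] f by (auto simp: P_iff)
  have "inj_on (\<lambda>y. a (\<sigma> y)) (ran f)"
  proof (rule inj_onI)
    fix y y' assume "y \<in> ran f" "y' \<in> ran f" "a (\<sigma> y) = a (\<sigma> y')"
    with \<sigma>[of y] \<sigma>[of y'] show "y = y'" by force
  qed
  then have inj: "inj_on \<sigma> (ran f)" "inj_on a (\<sigma> ` ran f)"
    by (auto simp: inj_on_def)
  have "\<sigma> ` ran f \<subseteq> dom a" using \<sigma> by blast
  then have "map_option \<sigma> \<circ> g \<in> P"
    using inj by (intro P_relabel[OF g]) (simp_all add: ran)
  moreover have "(map_option \<sigma> \<circ> g) \<star> f = g"
  proof (rule map_eqI)
    fix x z
    have "\<exists>w. a (\<sigma> y) = Some w \<and> f w = Some y" if "g x = Some y" for y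
      using \<sigma> that ran by (auto intro: ranI)
    then show "((map_option \<sigma> \<circ> g) \<star> f) x = Some z \<longleftrightarrow> g x = Some z"
      by (auto simp: sandwich_Some_iff)
  qed
  ultimately show ?thesis by blast
qed

text \<open>A right multiple \<open>g \<star> s\<close> identifies all points that \<open>g\<close>
  identifies and is defined at most where \<open>g\<close> is, so mutual divisibility forces equal
  kernels; \<open>right_factor\<close> gives the converse.\<close>

lemma greenR_iff: "(f, g) \<in> greenR P (\<star>) \<longleftrightarrow> f \<in> P \<and> g \<in> P \<and> pker f = pker g"
proof -
  have sub: "right_ideal P (\<star>) g \<subseteq> right_ideal P (\<star>) f"
    if fg: "f \<in> P" "g \<in> P" "pker f = pker g" for f g
  proof -
    obtain s where "s \<in> P" "f \<star> s = g" using right_factor[OF fg] by blast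
    then show ?thesis
      by (auto simp: right_ideal_def sandwich_assoc intro: P_closed)
  qed
  have "pker f = pker g" if "right_ideal P (\<star>) f = right_ideal P (\<star>) g" for f g
  proof -
    have "f \<in> right_ideal P (\<star>) g" "g \<in> right_ideal P (\<star>) f"
      using that by (auto simp: right_ideal_def)
    then obtain s t where s: "f = g \<or> f = g \<star> s" and t: "g = f \<or> g = f \<star> t"
      by (auto simp: right_ideal_def)
    have dom: "dom (g \<star> s) \<subseteq> dom g" for g s
      by (auto simp: sandwich_Some_iff)
    have eq: "(g \<star> s) x = (g \<star> s) x'" if "g x = g x'" for g s x x'
      using that by (simp add: sandwich_def pcomp_def map_comp_def)
    show ?thesis
    proof (rule pker_eqI)
      show "dom f = dom g"
        using s t dom by (metis subset_antisym)
      show "f x = f x' \<longleftrightarrow> g x = g x'" for x x'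
        using s t eq by metis
    qed
  qed
  then show ?thesis
    using sub[of f g] sub[of g f] unfolding greenR_def by blast
qed

lemma greenL_iff: "(f, g) \<in> greenL P (\<star>) \<longleftrightarrow> f \<in> P \<and> g \<in> P \<and> ran f = ran g"
proof -
  have sub: "left_ideal P (\<star>) g \<subseteq> left_ideal P (\<star>) f"
    if fg: "f \<in> P" "g \<in> P" "ran f = ran g" for f g
  proof -
    obtain s where "s \<in> P" "s \<star> f = g" using left_factor[OF fg] by blast
    then show ?thesis
      by (auto simp: left_ideal_def intro: P_closed) (metis P_closed sandwich_assoc)
  qed
  have "ran f \<subseteq> ran g" if "left_ideal P (\<star>) f = left_ideal P (\<star>) g" for f g
  proof -
    have "f \<in> left_ideal P (\<star>) g"
      using that by (auto simp: left_ideal_def)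
    then show ?thesis
      by (auto simp: left_ideal_def ran_def sandwich_Some_iff)
  qed
  then have "ran f = ran g" if "left_ideal P (\<star>) f = left_ideal P (\<star>) g"
    using that by (metis subset_antisym)
  then show ?thesis
    using sub[of f g] sub[of g f] unfolding greenL_def by blast
qed

lemma greenH_iff: "(f, g) \<in> greenH P (\<star>) \<longleftrightarrow> f \<in> P \<and> g \<in> P \<and> pker f = pker g \<and> ran f = ran g"
  by (auto simp: greenH_def greenR_iff greenL_iff)

text \<open>Relabelling along a bijection of \<open>ran f\<close> with \<open>Z\<close> keeps the
  kernel, so kernels and images of equal rank combine freely.\<close>

lemma ex_pker_ran:
  assumes f: "f \<in> P" and Z: "|ran f| =o |Z|" "Z \<subseteq> dom a" "inj_on a Z"
  shows "\<exists>g\<in>P. pker g = pker f \<and> ran g = Z"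
proof -
  obtain \<sigma> where "bij_betw \<sigma> (ran f) Z"
    using Z(1) card_of_ordIso by blast
  then show ?thesis
    using f Z by (intro bexI[of _ "map_option \<sigma> \<circ> f"])
      (auto simp: bij_betw_def ran_map_option_comp pker_map_option P_relabel)
qed

text \<open>\<R>-steps and \<L>-steps preserve the rank. Conversely, an element with the kernel of
  \<open>f\<close> and the image of \<open>g\<close> links the two by one step of each kind.\<close>

lemma greenD_iff: "(f, g) \<in> greenD P (\<star>) \<longleftrightarrow> f \<in> P \<and> g \<in> P \<and> |ran f| =o |ran g|"
proof
  assume "(f, g) \<in> greenD P (\<star>)"
  then show "f \<in> P \<and> g \<in> P \<and> |ran f| =o |ran g|"
    unfolding greenD_def
  proof (induction rule: trancl_induct)
    case (base g)
    then show ?case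
      by (auto simp: greenR_iff greenL_iff pker_eq_card_ran)
  next
    case (step g h)
    then have "|ran g| =o |ran h|"
      by (auto simp: greenR_iff greenL_iff pker_eq_card_ran)
    with step show ?case
      using ordIso_transitive by (auto simp: greenR_iff greenL_iff)
  qed
next
  assume *: "f \<in> P \<and> g \<in> P \<and> |ran f| =o |ran g|"
  then obtain h where "h \<in> P" "pker h = pker f" "ran h = ran g"
    using ex_pker_ran[of f "ran g"] by (auto simp: P_iff)
  with * have "(f, h) \<in> greenR P (\<star>)" "(h, g) \<in> greenL P (\<star>)"
    by (auto simp: greenR_iff greenL_iff)
  then show "(f, g) \<in> greenD P (\<star>)"
    unfolding greenD_def by (meson UnI1 UnI2 r_into_trancl trancl_into_trancl)
qed


section \<open>Coordinates on the blown-up classes\<close>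

definition Rhat_class :: "('x \<rightharpoonup> 'y) \<Rightarrow> ('x \<rightharpoonup> 'y) set" where
  "Rhat_class f = {g \<in> P. pker (g |` ran a) = pker (f |` ran a)}"

definition Lhat_class :: "('x \<rightharpoonup> 'y) \<Rightarrow> ('x \<rightharpoonup> 'y) set" where
  "Lhat_class f = {g \<in> P. a ` ran g = a ` ran f}"

definition Hhat_class :: "('x \<rightharpoonup> 'y) \<Rightarrow> ('x \<rightharpoonup> 'y) set" where
  "Hhat_class f = Rhat_class f \<inter> Lhat_class f"

text \<open>Each \<open>\<R>\<close>-class of \<open>P\<close> in \<open>Rhat_class f\<close> contains exactly one element of \<open>normal_forms f\<close>.\<close>

definition normal_forms :: "('x \<rightharpoonup> 'y) \<Rightarrow> ('x \<rightharpoonup> 'y) set" where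
  "normal_forms f = {g \<in> P. g |` ran a = f |` ran a}"

definition transversals :: "('x \<rightharpoonup> 'y) \<Rightarrow> 'y set set" where
  "transversals f = {Z. Z \<subseteq> dom a \<and> inj_on a Z \<and> a ` Z = a ` ran f}"

text \<open>For \<open>Z\<close> in \<open>transversals f\<close> and \<open>y\<close> in
  \<open>ran f\<close>, this is the point of \<open>Z\<close> in the same fibre of \<open>a\<close>
  as \<open>y\<close>.\<close>

definition lift :: "'y set \<Rightarrow> 'y \<Rightarrow> 'y" where
  "lift Z y = inv_into Z a (a y)"

text \<open>In order of application: \<open>n\<close> fixes the kernel, \<open>s\<close> permutes
  \<open>ran f\<close>, and \<open>lift Z\<close> moves each value within its fibre of
  \<open>a\<close> into \<open>Z\<close>.\<close>

definition assemble :: "('y \<Rightarrow> 'y) \<times> ('x \<rightharpoonup> 'y) \<times> 'y set \<Rightarrow> ('x \<rightharpoonup> 'y)" where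
  "assemble = (\<lambda>(s, n, Z). map_option (\<lambda>y. lift Z (s y)) \<circ> n)"

lemma P_ran_restrict: "f \<in> P \<Longrightarrow> ran (f |` ran a) = ran f"
  by (simp add: P_iff)

lemma normal_forms_ran: "f \<in> P \<Longrightarrow> n \<in> normal_forms f \<Longrightarrow> ran n = ran f"
  using P_ran_restrict[of f] P_ran_restrict[of n] by (auto simp: normal_forms_def)

lemma normal_forms_eq:
  assumes "n \<in> normal_forms f" "x \<in> ran a"
  shows "n x = f x"
proof -
  have "(n |` ran a) x = (f |` ran a) x"
    using assms(1) by (simp add: normal_forms_def)
  with assms(2) show ?thesis by simp
qed

lemma normal_forms_subset: "normal_forms f \<subseteq> Rhat_class f"
  by (auto simp: normal_forms_def Rhat_class_def)

text \<open>Since \<open>g\<close> attains all its values on \<open>ran a\<close>, the relabelling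
  that turns \<open>g\<close> into \<open>f\<close> there is defined on the whole of
  \<open>ran g\<close> and can be applied to \<open>g\<close> everywhere.\<close>

lemma ex_normal_form:
  assumes f: "f \<in> P" and g: "g \<in> Rhat_class f"
  shows "\<exists>n\<in>normal_forms f. pker n = pker g"
proof -
  have gP: "g \<in> P" and ker: "pker (g |` ran a) = pker (f |` ran a)"
    using g by (auto simp: Rhat_class_def)
  obtain \<sigma> where \<sigma>: "bij_betw \<sigma> (ran g) (ran f)" "f |` ran a = map_option \<sigma> \<circ> (g |` ran a)"
    using pker_eq_relabel[OF ker] by (auto simp: P_ran_restrict f gP)
  have "map_option \<sigma> \<circ> g \<in> P"
    using f gP \<sigma>(1) by (intro P_relabel) (auto simp: bij_betw_def P_iff)
  moreover have "(map_option \<sigma> \<circ> g) |` ran a = f |` ran a"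
    unfolding \<sigma>(2) by (auto simp: restrict_map_def)
  moreover have "pker (map_option \<sigma> \<circ> g) = pker g"
    using \<sigma>(1) by (intro pker_map_option) (simp add: bij_betw_def)
  ultimately show ?thesis
    by (auto simp: normal_forms_def)
qed

text \<open>A value of \<open>n\<close> at \<open>x\<close> is also attained at some
  \<open>w\<close> in \<open>ran a\<close>, where \<open>n\<close> and \<open>n'\<close> both agree
  with \<open>f\<close>; the common kernel ties the values at \<open>x\<close> to those at
  \<open>w\<close>.\<close>

lemma inj_on_pker_normal_forms:
  assumes f: "f \<in> P"
  shows "inj_on pker (normal_forms f)"
proof -
  have *: "n' x = Some y"
    if n: "n \<in> normal_forms f" "n' \<in> normal_forms f" and ker: "pker n = pker n'" and x: "n x = Some y"
    for n n' x y
  proof -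
    have "y \<in> ran (n |` ran a)"
      using n(1) P_ran_restrict[of n] x by (auto simp: normal_forms_def intro: ranI)
    then obtain w where w: "w \<in> ran a" "n w = Some y"
      by (auto simp: ran_restrict_iff)
    have "n' w = n w"
      using w(1) normal_forms_eq[OF n(1)] normal_forms_eq[OF n(2)] by simp
    moreover have "n' x = n' w"
      using pker_eqD[OF ker, of x w] x w by simp
    ultimately show ?thesis using w by simp
  qed
  show ?thesis
  proof (rule inj_onI)
    fix n n' assume n: "n \<in> normal_forms f" "n' \<in> normal_forms f" "pker n = pker n'"
    show "n = n'"
    proof (rule map_eqI)
      fix x z show "n x = Some z \<longleftrightarrow> n' x = Some z"
        using *[OF n(1,2,3)] *[OF n(2,1) n(3)[symmetric]] by (rule iffI)
    qed
  qed
qed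

lemma pker_image_normal_forms: "f \<in> P \<Longrightarrow> pker ` normal_forms f = pker ` Rhat_class f"
proof
  assume f: "f \<in> P"
  show "pker ` Rhat_class f \<subseteq> pker ` normal_forms f"
  proof (rule image_subsetI)
    fix g assume "g \<in> Rhat_class f"
    then obtain n where "n \<in> normal_forms f" "pker n = pker g"
      using ex_normal_form[OF f] by blast
    then show "pker g \<in> pker ` normal_forms f"
      by (intro image_eqI[of _ _ n]) simp_all
  qed
qed (rule image_mono[OF normal_forms_subset])

text \<open>On \<open>ran a\<close> a normal form is prescribed and already covers
  \<open>ran f\<close>. At each other point of \<open>X\<close> it may take any value in
  \<open>ran f\<close> or be undefined, and it stays regular.\<close>

lemma card_normal_forms:
  assumes f: "f \<in> P"
  shows "|normal_forms f| =o ( |ran f| +c cone) ^c |X - ran a|"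
proof -
  \<comment> \<open>\<open>Inr ()\<close> encodes an undefined value and accounts for the one added
    in the base; the value \<open>undefined\<close> off \<open>X - ran a\<close> is what
    \<open>Func\<close> requires.\<close>
  define F where "F n x = (if x \<in> X - ran a then case n x of Some y \<Rightarrow> Inl y | None \<Rightarrow> Inr () else undefined)"
    for n :: "'x \<rightharpoonup> 'y" and x
  let ?C = "Func (X - ran a) (ran f <+> {()})"
  have "bij_betw F (normal_forms f) ?C"
  proof (rule bij_betw_imageI)
    show "inj_on F (normal_forms f)"
    proof (rule inj_onI)
      fix n n' assume n: "n \<in> normal_forms f" "n' \<in> normal_forms f" and eq: "F n = F n'"
      show "n = n'"
      proof
        fix x
        consider "x \<in> ran a" | "x \<in> X - ran a" | "x \<notin> X" by blast
        then show "n x = n' x"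
        proof cases
          case 1
          then show ?thesis
            using normal_forms_eq[OF n(1)] normal_forms_eq[OF n(2)] by simp
        next
          case 2
          then show ?thesis
            using fun_cong[OF eq, of x] by (simp add: F_def split: option.splits)
        next
          case 3
          then have "x \<notin> dom n" "x \<notin> dom n'"
            using n by (auto simp: normal_forms_def P_iff)
          then show ?thesis by (simp add: domIff)
        qed
      qed
    qed
    show "F ` normal_forms f = ?C"
    proof
      show "F ` normal_forms f \<subseteq> ?C"
        using normal_forms_ran[OF f, symmetric]
        by (auto simp: Func_def F_def split: option.splits intro: ranI)
      show "?C \<subseteq> F ` normal_forms f"
      proof
        fix h assume h: "h \<in> ?C"
        define n where "n x = (if x \<in> ran a then f x else if x \<in> X
          then (case h x of Inl y \<Rightarrow> Some y | Inr _ \<Rightarrow> None) else None)" for x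
        have hx: "h x \<in> ran f <+> {()}" if "x \<in> X - ran a" for x
          using h that by (auto simp: Func_def)
        have res: "n |` ran a = f |` ran a"
          by (auto simp: n_def restrict_map_def)
        have "ran n \<subseteq> ran f"
        proof
          fix y assume "y \<in> ran n"
          then obtain x where "n x = Some y" by (auto simp: ran_def)
          then show "y \<in> ran f"
            using hx[of x] by (auto simp: n_def split: if_splits sum.splits intro: ranI)
        qed
        moreover have "ran (n |` ran a) \<subseteq> ran n"
          by (auto simp: ran_restrict_iff intro: ranI)
        ultimately have "ran n = ran f"
          using P_ran_restrict[OF f] by (simp add: res subset_antisym)
        moreover have "dom n \<subseteq> X"
          using ran_a_subset by (auto simp: n_def split: if_splits)
        ultimately have "n \<in> normal_forms f"
          using f res by (simp add: normal_forms_def P_iff)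
        moreover have "F n = h"
        proof
          fix x show "F n x = h x"
            using hx[of x] h by (auto simp: F_def n_def Func_def split: sum.splits)
        qed
        ultimately show "h \<in> F ` normal_forms f" by blast
      qed
    qed
  qed
  then show ?thesis
    by (simp add: cexp_def csum_def cone_def Field_card_of card_of_ordIsoI)
qed

lemma card_pker_normal_forms:
  "f \<in> P \<Longrightarrow> |pker ` normal_forms f| =o ( |ran f| +c cone) ^c |X - ran a|"
  by (rule ordIso_transitive[OF ordIso_symmetric card_normal_forms])
    (rule card_of_ordIsoI[OF inj_on_imp_bij_betw[OF inj_on_pker_normal_forms]])

lemma lift:
  assumes "Z \<in> transversals f" "f \<in> P"
  shows "bij_betw (lift Z) (ran f) Z" "y \<in> ran f \<Longrightarrow> a (lift Z y) = a y"
proof -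
  have Z: "inj_on a Z" "a ` Z = a ` ran f" and f: "inj_on a (ran f)"
    using assms by (auto simp: transversals_def P_iff)
  have "bij_betw (inv_into Z a) (a ` ran f) Z"
    using bij_betw_inv_into[OF inj_on_imp_bij_betw[OF Z(1)]] Z(2) by simp
  from bij_betw_trans[OF inj_on_imp_bij_betw[OF f] this] show "bij_betw (lift Z) (ran f) Z"
    by (simp add: lift_def[abs_def] o_def)
  show "a (lift Z y) = a y" if "y \<in> ran f"
    unfolding lift_def using that Z(2) by (intro f_inv_into_f) simp
qed

lemma Bij_iff: "s \<in> Bij S \<longleftrightarrow> s \<in> extensional S \<and> bij_betw s S S"
  by (simp add: Bij_def)

text \<open>\<open>s\<close> followed by \<open>lift Z\<close> is a bijection of
  \<open>ran f\<close> with \<open>Z\<close>, so \<open>assemble\<close> only relabels the values of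
  \<open>n\<close>.\<close>

lemma assemble:
  assumes f: "f \<in> P" and s: "s \<in> Bij (ran f)" and n: "n \<in> normal_forms f" and Z: "Z \<in> transversals f"
  shows "assemble (s, n, Z) \<in> Hhat_class f" "pker (assemble (s, n, Z)) = pker n"
    "ran (assemble (s, n, Z)) = Z"
proof -
  have b: "bij_betw (\<lambda>y. lift Z (s y)) (ran n) Z"
    using bij_betw_trans[of s "ran f" "ran f" "lift Z" Z] s lift(1)[OF Z f]
    by (simp add: Bij_iff normal_forms_ran[OF f n] o_def)
  then have im: "(\<lambda>y. lift Z (s y)) ` ran n = Z" and inj: "inj_on (\<lambda>y. lift Z (s y)) (ran n)"
    by (auto simp: bij_betw_def)
  show ker: "pker (assemble (s, n, Z)) = pker n"
    using inj by (simp add: assemble_def pker_map_option)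
  show ran: "ran (assemble (s, n, Z)) = Z"
    using im by (simp add: assemble_def ran_map_option_comp)
  have nP: "n \<in> P" "n |` ran a = f |` ran a"
    using n by (auto simp: normal_forms_def)
  have Z': "Z \<subseteq> dom a" "inj_on a Z" "a ` Z = a ` ran f"
    using Z by (auto simp: transversals_def)
  have P: "assemble (s, n, Z) \<in> P"
    unfolding assemble_def using nP(1) inj im Z' by (auto intro!: P_relabel)
  have "assemble (s, n, Z) |` ran a = map_option (\<lambda>y. lift Z (s y)) \<circ> (n |` ran a)"
    by (auto simp: assemble_def restrict_map_def)
  then have "pker (assemble (s, n, Z) |` ran a) = pker (n |` ran a)"
    using inj by (simp add: pker_map_option P_ran_restrict[OF nP(1)])
  with P ran Z' nP show "assemble (s, n, Z) \<in> Hhat_class f"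
    by (simp add: Hhat_class_def Rhat_class_def Lhat_class_def)
qed

text \<open>The kernel of the result determines \<open>n\<close>, its image is \<open>Z\<close>, and
  injectivity of \<open>lift Z\<close> recovers \<open>s\<close>. For surjectivity, \<open>n\<close>
  is the normal form with the kernel of \<open>h\<close>, and \<open>s\<close> is the relabelling
  from \<open>n\<close> to \<open>h\<close> pulled back through \<open>lift\<close>.\<close>

lemma bij_betw_assemble:
  assumes f: "f \<in> P"
  shows "bij_betw assemble (Bij (ran f) \<times> normal_forms f \<times> transversals f) (Hhat_class f)"
  (is "bij_betw _ ?D _")
proof (rule bij_betw_imageI)
  show "inj_on assemble ?D"
  proof (rule inj_onI)
    fix p p' assume p: "p \<in> ?D" "p' \<in> ?D" and eq: "assemble p = assemble p'"
    obtain s n Z s' n' Z' where pp: "p = (s, n, Z)" "p' = (s', n', Z')"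
      by (metis prod_cases3)
    have sn: "s \<in> Bij (ran f)" "n \<in> normal_forms f" "Z \<in> transversals f"
      "s' \<in> Bij (ran f)" "n' \<in> normal_forms f" "Z' \<in> transversals f"
      using p pp by auto
    have "Z = Z'" "pker n = pker n'"
      using eq pp assemble(2,3)[OF f sn(1-3)] assemble(2,3)[OF f sn(4-6)] by auto
    then have nZ: "n = n'" "Z = Z'"
      using inj_on_pker_normal_forms[OF f] sn by (auto dest: inj_onD)
    have "s y = s' y" if y: "y \<in> ran f" for y
    proof -
      from y normal_forms_ran[OF f sn(2)] obtain x where "n x = Some y"
        by (auto simp: ran_def)
      with fun_cong[OF eq, of x] pp nZ have "lift Z (s y) = lift Z (s' y)"
        by (simp add: assemble_def)
      moreover have "s y \<in> ran f" "s' y \<in> ran f"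
        using sn y by (auto simp: Bij_iff bij_betw_def)
      ultimately show ?thesis
        using lift(1)[OF sn(3) f] by (auto simp: bij_betw_def dest: inj_onD)
    qed
    then have "s = s'"
      using sn by (auto simp: Bij_iff intro: extensionalityI)
    with nZ pp show "p = p'" by simp
  qed
  show "assemble ` ?D = Hhat_class f"
  proof
    show "assemble ` ?D \<subseteq> Hhat_class f"
      using assemble(1)[OF f] by auto
    show "Hhat_class f \<subseteq> assemble ` ?D"
    proof
      fix h assume h: "h \<in> Hhat_class f"
      then obtain n where n: "n \<in> normal_forms f" "pker n = pker h"
        using ex_normal_form[OF f, of h] by (auto simp: Hhat_class_def)
      have Z: "ran h \<in> transversals f"
        using h by (auto simp: Hhat_class_def Lhat_class_def P_iff transversals_def)
      obtain \<sigma> where \<sigma>: "bij_betw \<sigma> (ran f) (ran h)" "h = map_option \<sigma> \<circ> n"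
        using pker_eq_relabel[OF n(2)] normal_forms_ran[OF f n(1)] by auto
      \<comment> \<open>The restriction to \<open>ran f\<close> is there because \<open>Bij\<close>
        consists of extensional functions.\<close>
      define s where "s = (\<lambda>y\<in>ran f. inv_into (ran f) (lift (ran h)) (\<sigma> y))"
      have "bij_betw (inv_into (ran f) (lift (ran h)) \<circ> \<sigma>) (ran f) (ran f)"
        using \<sigma>(1) bij_betw_inv_into[OF lift(1)[OF Z f]] by (rule bij_betw_trans)
      then have "bij_betw s (ran f) (ran f)"
        by (rule bij_betw_cong[THEN iffD1, rotated]) (simp add: s_def)
      then have "s \<in> Bij (ran f)"
        by (simp add: Bij_iff s_def)
      moreover have s: "lift (ran h) (s y) = \<sigma> y" if y: "y \<in> ran f" for y
      proof -
        have "\<sigma> y \<in> lift (ran h) ` ran f"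
          using y \<sigma>(1) lift(1)[OF Z f] by (auto simp: bij_betw_def)
        with y show ?thesis by (simp add: s_def f_inv_into_f)
      qed
      have "assemble (s, n, ran h) = h"
      proof
        fix x show "assemble (s, n, ran h) x = h x"
        proof (cases "n x")
          case (Some y)
          then have "y \<in> ran f"
            using normal_forms_ran[OF f n(1)] by (auto intro: ranI)
          with Some s[of y] fun_cong[OF \<sigma>(2), of x] show ?thesis
            by (simp add: assemble_def)
        qed (use fun_cong[OF \<sigma>(2), of x] in \<open>simp add: assemble_def\<close>)
      qed
      ultimately show "h \<in> assemble ` ?D"
        using n Z by force
    qed
  qed
qed

text \<open>Kernel and image see only \<open>n\<close> and \<open>Z\<close>, and some permutation of
  \<open>ran f\<close> always exists, so the pairs fill a rectangle.\<close>

lemma pker_ran_image_Hhat_class: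
  assumes f: "f \<in> P"
  shows "(\<lambda>h. (pker h, ran h)) ` Hhat_class f = pker ` normal_forms f \<times> transversals f"
proof -
  have "(\<lambda>y\<in>ran f. y) \<in> Bij (ran f)" by (rule id_Bij)
  then have ne: "\<exists>s. s \<in> Bij (ran f)" by blast
  have "Hhat_class f = assemble ` (Bij (ran f) \<times> normal_forms f \<times> transversals f)"
    using bij_betw_assemble[OF f] by (simp add: bij_betw_def)
  then have "(\<lambda>h. (pker h, ran h)) ` Hhat_class f =
      (\<lambda>p. (pker (assemble p), ran (assemble p))) ` (Bij (ran f) \<times> normal_forms f \<times> transversals f)"
    by (simp add: image_image)
  also have "\<dots> = (\<lambda>(s, n, Z). (pker n, Z)) ` (Bij (ran f) \<times> normal_forms f \<times> transversals f)"
    by (rule image_cong) (auto simp: assemble(2,3)[OF f])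
  also have "\<dots> = pker ` normal_forms f \<times> transversals f"
    using ne by (auto simp: image_iff)
  finally show ?thesis .
qed

lemma ran_image_Lhat_class:
  assumes f: "f \<in> P"
  shows "ran ` Lhat_class f = transversals f"
proof
  show "ran ` Lhat_class f \<subseteq> transversals f"
    by (auto simp: Lhat_class_def transversals_def P_iff)
  show "transversals f \<subseteq> ran ` Lhat_class f"
  proof
    fix Z assume Z: "Z \<in> transversals f"
    then have "|ran f| =o |Z|" "Z \<subseteq> dom a" "inj_on a Z" "a ` Z = a ` ran f"
      using card_of_ordIsoI[OF lift(1)[OF Z f]] by (auto simp: transversals_def)
    moreover obtain g where "g \<in> P" "ran g = Z"
      using ex_pker_ran[OF f calculation(1-3)] by blast
    ultimately show "Z \<in> ran ` Lhat_class f"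
      by (auto simp: Lhat_class_def)
  qed
qed

text \<open>An \<H>-class fixes kernel and image, hence \<open>n\<close> and \<open>Z\<close>; only
  the permutation remains free, which gives its size.\<close>

lemma Hhat_class_Hclass:
  assumes f: "f \<in> P" and K: "K \<in> P // greenH P (\<star>)" "K \<subseteq> Hhat_class f"
  shows "\<exists>n\<in>normal_forms f. \<exists>Z\<in>transversals f. bij_betw (\<lambda>s. assemble (s, n, Z)) (Bij (ran f)) K"
proof -
  obtain g where g: "g \<in> P" "K = greenH P (\<star>) `` {g}"
    using K(1) by (auto simp: quotient_def)
  then have K': "K = {h \<in> P. pker h = pker g \<and> ran h = ran g}"
    by (auto simp: greenH_iff)
  have surj: "Hhat_class f = assemble ` (Bij (ran f) \<times> normal_forms f \<times> transversals f)"
    and inj: "inj_on assemble (Bij (ran f) \<times> normal_forms f \<times> transversals f)"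
    using bij_betw_assemble[OF f] by (auto simp: bij_betw_def)
  have "g \<in> Hhat_class f" using K(2) K' g(1) by blast
  then obtain s\<^sub>0 n Z where n: "s\<^sub>0 \<in> Bij (ran f)" "n \<in> normal_forms f" "Z \<in> transversals f"
    and g': "g = assemble (s\<^sub>0, n, Z)"
    unfolding surj by auto
  have gn: "pker g = pker n" "ran g = Z"
    using assemble[OF f n] by (simp_all add: g')
  have "inj_on (\<lambda>s. assemble (s, n, Z)) (Bij (ran f))"
  proof (rule inj_onI)
    fix s s' assume "s \<in> Bij (ran f)" "s' \<in> Bij (ran f)" "assemble (s, n, Z) = assemble (s', n, Z)"
    with n inj_onD[OF inj, of "(s, n, Z)" "(s', n, Z)"] show "s = s'" by simp
  qed
  moreover have "(\<lambda>s. assemble (s, n, Z)) ` Bij (ran f) = K"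
  proof
    show "(\<lambda>s. assemble (s, n, Z)) ` Bij (ran f) \<subseteq> K"
      using assemble[OF f _ n(2,3)] by (auto simp: K' gn Hhat_class_def Rhat_class_def)
    show "K \<subseteq> (\<lambda>s. assemble (s, n, Z)) ` Bij (ran f)"
    proof
      fix h assume h: "h \<in> K"
      then obtain s n' Z' where s: "s \<in> Bij (ran f)" "n' \<in> normal_forms f" "Z' \<in> transversals f"
        and h': "h = assemble (s, n', Z')"
        using K(2) surj by auto
      have "pker n' = pker n" "Z' = Z"
        using h assemble[OF f s] gn by (auto simp: K' h')
      then have "n' = n"
        using inj_on_pker_normal_forms[OF f] s(2) n(2) by (auto dest: inj_onD)
      with s h' \<open>Z' = Z\<close> show "h \<in> (\<lambda>s. assemble (s, n, Z)) ` Bij (ran f)" by blast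
    qed
  qed
  ultimately show ?thesis
    using n by (auto simp: bij_betw_def)
qed


section \<open>The group case\<close>

text \<open>The working form of the condition that the \<H>-class of \<open>bar a f\<close> is a
  group. Extensionality in \<open>Bij\<close> makes \<open>\<phi>\<close> unique.\<close>

definition permuted_by :: "('x \<rightharpoonup> 'y) \<Rightarrow> ('y \<Rightarrow> 'y) \<Rightarrow> bool" where
  "permuted_by f \<phi> \<longleftrightarrow> \<phi> \<in> Bij (ran f) \<and> (\<forall>y\<in>ran f. pcomp a f y = Some (\<phi> y))"

text \<open>\<open>lift Z\<close> does not change what \<open>a\<close> does to a value, so
  \<open>Z\<close> drops out. The point reached lies in \<open>ran a\<close>, where
  \<open>n'\<close> agrees with \<open>f\<close>, so \<open>n'\<close> drops out and
  \<open>\<phi>\<close> appears.\<close>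

lemma assemble_star:
  assumes f: "f \<in> P" and \<phi>: "permuted_by f \<phi>"
    and s: "s \<in> Bij (ran f)" "n \<in> normal_forms f" "Z \<in> transversals f"
    and s': "s' \<in> Bij (ran f)" "n' \<in> normal_forms f" "Z' \<in> transversals f"
  shows "assemble (s, n, Z) \<star> assemble (s', n', Z') =
    assemble (compose (ran f) s' (compose (ran f) \<phi> s), n, Z')"
proof (rule map_eqI)
  fix x z
  show "(assemble (s, n, Z) \<star> assemble (s', n', Z')) x = Some z \<longleftrightarrow>
    assemble (compose (ran f) s' (compose (ran f) \<phi> s), n, Z') x = Some z"
  proof (cases "n x")
    case None
    then show ?thesis by (simp add: sandwich_Some_iff assemble_def)
  next
    case (Some y)
    then have y: "y \<in> ran f"
      using normal_forms_ran[OF f s(2)] by (auto intro: ranI)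
    then have sy: "s y \<in> ran f"
      using s(1) by (auto simp: Bij_iff bij_betw_def)
    then obtain w where w: "a (s y) = Some w" "f w = Some (\<phi> (s y))"
      using \<phi> by (auto simp: permuted_by_def pcomp_Some_iff)
    then have "n' w = Some (\<phi> (s y))"
      using normal_forms_eq[OF s'(2), of w] by (auto intro: ranI)
    then show ?thesis
      using Some y w(1) lift(2)[OF s(3) f sy] by (simp add: sandwich_Some_iff assemble_def compose_eq)
  qed
qed

text \<open>\<open>BijGroup\<close> composes from right to left, so multiplying by
  \<open>\<phi>\<close> on the left turns the product of permutation coordinates into the reversed
  group product; the inverse restores the order.\<close>

lemma bij_betw_twisted_inverse:
  assumes "\<phi> \<in> Bij S"
  shows "bij_betw (\<lambda>s. inv\<^bsub>BijGroup S\<^esub> (\<phi> \<otimes>\<^bsub>BijGroup S\<^esub> s)) (Bij S) (carrier (BijGroup S))"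
proof -
  interpret G: group "BijGroup S" by (rule group_BijGroup)
  have c: "carrier (BijGroup S) = Bij S" by (simp add: BijGroup_def)
  have "inv\<^bsub>BijGroup S\<^esub> \<phi> \<otimes>\<^bsub>BijGroup S\<^esub> (\<phi> \<otimes>\<^bsub>BijGroup S\<^esub> s) = s"
    "\<phi> \<otimes>\<^bsub>BijGroup S\<^esub> (inv\<^bsub>BijGroup S\<^esub> \<phi> \<otimes>\<^bsub>BijGroup S\<^esub> s) = s" if "s \<in> carrier (BijGroup S)" for s
    using assms that by (simp_all add: c[symmetric] flip: G.m_assoc)
  then show ?thesis
    using assms unfolding c[symmetric]
    by (intro bij_betw_byWitness[where f' = "\<lambda>t. inv\<^bsub>BijGroup S\<^esub> \<phi> \<otimes>\<^bsub>BijGroup S\<^esub> inv\<^bsub>BijGroup S\<^esub> t"]) auto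
qed

lemma twisted_inverse_mult:
  assumes "\<phi> \<in> Bij S" "s \<in> Bij S" "s' \<in> Bij S"
  shows "inv\<^bsub>BijGroup S\<^esub> (\<phi> \<otimes>\<^bsub>BijGroup S\<^esub> compose S s' (compose S \<phi> s)) =
    inv\<^bsub>BijGroup S\<^esub> (\<phi> \<otimes>\<^bsub>BijGroup S\<^esub> s) \<otimes>\<^bsub>BijGroup S\<^esub> inv\<^bsub>BijGroup S\<^esub> (\<phi> \<otimes>\<^bsub>BijGroup S\<^esub> s')"
proof -
  interpret G: group "BijGroup S" by (rule group_BijGroup)
  have c: "carrier (BijGroup S) = Bij S" by (simp add: BijGroup_def)
  have "compose S s' (compose S \<phi> s) = s' \<otimes>\<^bsub>BijGroup S\<^esub> (\<phi> \<otimes>\<^bsub>BijGroup S\<^esub> s)"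
    using assms by (simp add: BijGroup_def compose_Bij)
  then show ?thesis
    using assms by (simp add: c[symmetric] G.inv_mult_group G.m_assoc)
qed

text \<open>By \<open>assemble_star\<close>, a product takes \<open>n\<close> from its left factor
  and \<open>Z\<close> from its right one; the twist \<open>\<theta>\<close> turns the product of
  the permutation coordinates into that of the group.\<close>

lemma Hhat_class_rectangular_group:
  assumes f: "f \<in> P" and \<phi>: "permuted_by f \<phi>"
    and r: "|normal_forms f| =o r" "Card_order r" and l: "|transversals f| =o l" "Card_order l"
  shows "rectangular_group (Hhat_class f) (\<star>) r l (BijGroup (ran f))"
proof -
  let ?D = "Bij (ran f) \<times> normal_forms f \<times> transversals f" and ?G = "BijGroup (ran f)"
  have \<phi>B: "\<phi> \<in> Bij (ran f)" using \<phi> by (simp add: permuted_by_def)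
  define \<theta> where "\<theta> s = inv\<^bsub>?G\<^esub> (\<phi> \<otimes>\<^bsub>?G\<^esub> s)" for s
  define c where "c = inv_into ?D assemble"
  note b = bij_betw_assemble[OF f]
  have c: "bij_betw c (Hhat_class f) ?D"
    unfolding c_def by (rule bij_betw_inv_into[OF b])
  have cI: "c (assemble p) = p" if "p \<in> ?D" for p
    unfolding c_def using b that by (rule bij_betw_inv_into_left)
  have ex: "\<exists>s n Z. s \<in> Bij (ran f) \<and> n \<in> normal_forms f \<and> Z \<in> transversals f \<and> h = assemble (s, n, Z)"
    if "h \<in> Hhat_class f" for h
  proof -
    have "h \<in> assemble ` ?D" using b that by (simp add: bij_betw_def)
    then show ?thesis by blast
  qed
  have closed: "compose (ran f) s' (compose (ran f) \<phi> s) \<in> Bij (ran f)"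
    if "s \<in> Bij (ran f)" "s' \<in> Bij (ran f)" for s s'
    using that \<phi>B by (simp add: compose_Bij)
  have prod: "g \<star> h \<in> Hhat_class f \<and> \<theta> (fst (c (g \<star> h))) = \<theta> (fst (c g)) \<otimes>\<^bsub>?G\<^esub> \<theta> (fst (c h)) \<and>
      fst (snd (c (g \<star> h))) = fst (snd (c g)) \<and> snd (snd (c (g \<star> h))) = snd (snd (c h))"
    if gh: "g \<in> Hhat_class f" "h \<in> Hhat_class f" for g h
  proof -
    obtain s n Z where s: "s \<in> Bij (ran f)" "n \<in> normal_forms f" "Z \<in> transversals f" "g = assemble (s, n, Z)"
      using ex[OF gh(1)] by blast
    obtain s' n' Z' where s': "s' \<in> Bij (ran f)" "n' \<in> normal_forms f" "Z' \<in> transversals f" "h = assemble (s', n', Z')"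
      using ex[OF gh(2)] by blast
    have "g \<star> h = assemble (compose (ran f) s' (compose (ran f) \<phi> s), n, Z')"
      unfolding s(4) s'(4) by (rule assemble_star[OF f \<phi> s(1-3) s'(1-3)])
    then show ?thesis
      using s s' closed[OF s(1) s'(1)] twisted_inverse_mult[OF \<phi>B s(1) s'(1)]
      by (simp add: cI assemble(1)[OF f] \<theta>_def)
  qed
  show ?thesis
  proof (rule rectangular_groupI[OF group_BijGroup _ r l])
    have "bij_betw (map_prod \<theta> id) ?D (carrier ?G \<times> normal_forms f \<times> transversals f)"
      using bij_betw_map_prod[OF bij_betw_twisted_inverse[OF \<phi>B] bij_betw_id] by (simp add: \<theta>_def[abs_def])
    from bij_betw_trans[OF c this]
    show "bij_betw (\<lambda>h. (\<theta> (fst (c h)), (fst (snd (c h)), snd (snd (c h))))) (Hhat_class f)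
        (carrier ?G \<times> (normal_forms f \<times> transversals f))"
      by (simp add: o_def map_prod_def case_prod_beta)
    show "semigroup_on (Hhat_class f) (\<star>)"
      using prod by (intro semigroup_on_P) (auto simp: Hhat_class_def Rhat_class_def)
  qed (use prod in auto)
qed

lemma Hclass_group:
  assumes f: "f \<in> P" and \<phi>: "permuted_by f \<phi>"
    and K: "K \<in> P // greenH P (\<star>)" "K \<subseteq> Hhat_class f"
  shows "is_group_iso_to K (\<star>) (BijGroup (ran f))"
proof -
  let ?G = "BijGroup (ran f)"
  obtain n Z where n: "n \<in> normal_forms f" and Z: "Z \<in> transversals f"
    and b: "bij_betw (\<lambda>s. assemble (s, n, Z)) (Bij (ran f)) K"
    using Hhat_class_Hclass[OF f K] by blast
  have \<phi>B: "\<phi> \<in> Bij (ran f)" using \<phi> by (simp add: permuted_by_def)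
  define \<theta> where "\<theta> s = inv\<^bsub>?G\<^esub> (\<phi> \<otimes>\<^bsub>?G\<^esub> s)" for s
  define c where "c = inv_into (Bij (ran f)) (\<lambda>s. assemble (s, n, Z))"
  have c: "bij_betw c K (Bij (ran f))"
    unfolding c_def by (rule bij_betw_inv_into[OF b])
  have cI: "c (assemble (s, n, Z)) = s" if "s \<in> Bij (ran f)" for s
    unfolding c_def using bij_betw_inv_into_left[OF b that] .
  have prod: "g \<star> h \<in> K \<and> \<theta> (c (g \<star> h)) = \<theta> (c g) \<otimes>\<^bsub>?G\<^esub> \<theta> (c h)"
    if gh: "g \<in> K" "h \<in> K" for g h
  proof -
    obtain s s' where s: "s \<in> Bij (ran f)" "g = assemble (s, n, Z)"
      and s': "s' \<in> Bij (ran f)" "h = assemble (s', n, Z)"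
      using b gh by (auto simp: bij_betw_def)
    let ?t = "compose (ran f) s' (compose (ran f) \<phi> s)"
    have t: "?t \<in> Bij (ran f)"
      using s s' \<phi>B by (simp add: compose_Bij)
    have "g \<star> h = assemble (?t, n, Z)"
      unfolding s(2) s'(2) by (rule assemble_star[OF f \<phi> s(1) n Z s'(1) n Z])
    moreover have "assemble (?t, n, Z) \<in> K"
      using b t by (auto simp: bij_betw_def)
    ultimately show ?thesis
      using s s' t twisted_inverse_mult[OF \<phi>B s(1) s'(1)] by (simp add: cI \<theta>_def)
  qed
  show ?thesis
  proof (rule is_group_iso_toI[OF group_BijGroup])
    show "bij_betw (\<lambda>h. \<theta> (c h)) K (carrier ?G)"
      using bij_betw_trans[OF c bij_betw_twisted_inverse[OF \<phi>B]] by (simp add: \<theta>_def o_def)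
  qed (use prod in auto)
qed

text \<open>An idempotent \<open>e\<close> fixes its image pointwise and puts each \<open>v\<close>
  into the kernel class of \<open>e v\<close>, so \<open>ran e\<close> contains exactly one point of
  each class of the common kernel. Hence \<open>f\<close> maps \<open>ran e\<close> bijectively onto
  \<open>ran f\<close>, while \<open>a\<close> maps \<open>ran f\<close> bijectively onto
  \<open>ran e\<close>; the composite is \<open>\<phi>\<close>.\<close>

lemma idempotent_imp_permuted:
  assumes f: "f \<in> P" and e: "dom e \<subseteq> ran a" "pcomp e e = e"
    and ker: "pker e = pker (f |` ran a)" and ran: "ran e = ran (pcomp f a)"
  shows "\<exists>\<phi>. permuted_by f \<phi>"
proof -
  have fix_e: "e w = Some w" if w: "w \<in> ran e" for w
  proof -
    from w obtain v where v: "e v = Some w" by (auto simp: ran_def)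
    then have "pcomp e e v = Some w" by (simp add: e(2))
    with v show ?thesis by (auto simp: pcomp_Some_iff)
  qed
  have af: "\<exists>w y'. a y = Some w \<and> w \<in> ran e \<and> f w = Some y'" if y: "y \<in> ran f" for y
  proof -
    obtain x w where x: "f x = Some y" "a y = Some w"
      using y f by (auto simp: ran_def P_iff)
    then have "pcomp f a x = Some w" by (auto simp: pcomp_Some_iff)
    then have w: "w \<in> ran e" unfolding ran by (rule ranI)
    then have "w \<in> dom (f |` ran a)"
      using fix_e pker_eq_dom[OF ker] by blast
    with x w show ?thesis by auto
  qed
  define \<phi> where "\<phi> = (\<lambda>y\<in>ran f. the (pcomp a f y))"
  have \<phi>: "\<exists>w. a y = Some w \<and> w \<in> ran e \<and> f w = Some (\<phi> y)" if y: "y \<in> ran f" for y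
  proof -
    obtain w y' where w: "a y = Some w" "w \<in> ran e" "f w = Some y'" using af[OF y] by blast
    then have "pcomp a f y = Some y'" by (auto simp: pcomp_Some_iff)
    with w y show ?thesis by (auto simp: \<phi>_def)
  qed
  have ran_e: "ran e \<subseteq> ran a"
    unfolding ran by (auto simp: ran_def pcomp_Some_iff)
  have "bij_betw \<phi> (ran f) (ran f)"
  proof (rule bij_betw_imageI)
    show "inj_on \<phi> (ran f)"
    proof (rule inj_onI)
      fix y y' assume y: "y \<in> ran f" "y' \<in> ran f" and eq: "\<phi> y = \<phi> y'"
      obtain w where w: "a y = Some w" "w \<in> ran e" "f w = Some (\<phi> y)" using \<phi>[OF y(1)] by blast
      obtain w' where w': "a y' = Some w'" "w' \<in> ran e" "f w' = Some (\<phi> y')" using \<phi>[OF y(2)] by blast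
      have "w \<in> ran a" "w' \<in> ran a"
        using w w' ran_e by blast+
      then have "(f |` ran a) w = (f |` ran a) w'"
        using w(3) w'(3) eq by simp
      then have "e w = e w'" by (rule pker_eqD[OF ker[symmetric]])
      then have "a y = a y'" using w w' fix_e by simp
      then show "y = y'" using f y by (auto simp: P_iff dest: inj_onD)
    qed
    show "\<phi> ` ran f = ran f"
    proof
      show "\<phi> ` ran f \<subseteq> ran f" using \<phi> by (blast intro: ranI)
      show "ran f \<subseteq> \<phi> ` ran f"
      proof
        fix y assume "y \<in> ran f"
        then obtain v where v: "v \<in> ran a" "f v = Some y"
          using P_ran_restrict[OF f] ran_restrict_iff[of y f "ran a"] by blast
        then have "v \<in> dom e" using pker_eq_dom[OF ker] by auto
        then obtain w where w: "e v = Some w" by auto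
        then have wr: "w \<in> ran e" by (rule ranI)
        \<comment> \<open>\<open>v\<close> and \<open>w\<close> are kernel equivalent because
          \<open>e\<close> fixes \<open>w\<close>. So \<open>y\<close> is attained at
          \<open>w\<close>, which is the image under \<open>a\<close> of some value
          \<open>y\<^sub>0\<close> of \<open>f\<close>.\<close>
        then have "e v = e w" using w fix_e by simp
        then have "(f |` ran a) v = (f |` ran a) w" by (rule pker_eqD[OF ker])
        then have fw: "f w = Some y" using v wr ran_e by auto
        obtain x y\<^sub>0 where "f x = Some y\<^sub>0" "a y\<^sub>0 = Some w"
          using wr unfolding ran by (auto simp: ran_def pcomp_Some_iff)
        then have "y\<^sub>0 \<in> ran f" "\<phi> y\<^sub>0 = y"
          using \<phi>[of y\<^sub>0] fw by (auto intro: ranI)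
        then show "y \<in> \<phi> ` ran f" by blast
      qed
    qed
  qed
  moreover have "pcomp a f y = Some (\<phi> y)" if "y \<in> ran f" for y
    using \<phi>[OF that] by (auto simp: pcomp_Some_iff)
  ultimately show ?thesis
    by (auto simp: permuted_by_def Bij_iff \<phi>_def)
qed

section \<open>The classes of a given rank\<close>

definition rank_class :: "('x \<rightharpoonup> 'y) \<Rightarrow> ('x \<rightharpoonup> 'y) set" where
  "rank_class f = {g \<in> P. |ran g| =o |ran f|}"

lemma ran_image_rank_class:
  assumes f: "f \<in> P"
  shows "ran ` rank_class f = {Z. Z \<subseteq> dom a \<and> inj_on a Z \<and> |Z| =o |ran f|}"
proof
  show "ran ` rank_class f \<subseteq> {Z. Z \<subseteq> dom a \<and> inj_on a Z \<and> |Z| =o |ran f|}"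
    by (auto simp: rank_class_def P_iff)
  show "{Z. Z \<subseteq> dom a \<and> inj_on a Z \<and> |Z| =o |ran f|} \<subseteq> ran ` rank_class f"
  proof
    fix Z assume "Z \<in> {Z. Z \<subseteq> dom a \<and> inj_on a Z \<and> |Z| =o |ran f|}"
    then have Z: "Z \<subseteq> dom a" "inj_on a Z" "|Z| =o |ran f|" by auto
    obtain g where "g \<in> P" "ran g = Z"
      using ex_pker_ran[OF f ordIso_symmetric[OF Z(3)] Z(1,2)] by blast
    with Z show "Z \<in> ran ` rank_class f"
      by (auto simp: rank_class_def)
  qed
qed

lemma pker_ran_image_rank_class:
  "(\<lambda>g. (pker g, ran g)) ` rank_class f = pker ` rank_class f \<times> ran ` rank_class f"
proof
  show "(\<lambda>g. (pker g, ran g)) ` rank_class f \<subseteq> pker ` rank_class f \<times> ran ` rank_class f"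
    by auto
  show "pker ` rank_class f \<times> ran ` rank_class f \<subseteq> (\<lambda>g. (pker g, ran g)) ` rank_class f"
  proof
    fix p assume "p \<in> pker ` rank_class f \<times> ran ` rank_class f"
    then obtain g h where p: "p = (pker g, ran h)" and gh: "g \<in> rank_class f" "h \<in> rank_class f"
      by auto
    then have fg: "|ran g| =o |ran f|" "|ran h| =o |ran f|" "g \<in> P" "h \<in> P"
      by (auto simp: rank_class_def)
    have "|ran g| =o |ran h|"
      by (rule ordIso_transitive[OF fg(1) ordIso_symmetric[OF fg(2)]])
    with fg(3,4) obtain k where k: "k \<in> P" "pker k = pker g" "ran k = ran h"
      using ex_pker_ran[of g "ran h"] by (auto simp: P_iff)
    with fg have "k \<in> rank_class f" by (auto simp: rank_class_def)
    with k p show "p \<in> (\<lambda>g. (pker g, ran g)) ` rank_class f"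
      by (intro image_eqI[of _ _ k]) simp_all
  qed
qed

text \<open>Adjoin one point to \<open>ran a\<close> and join it to the points of
  \<open>ran a\<close> where \<open>g\<close> is undefined. The restricted kernels then become the
  equivalence relations on the enlarged set with one class more than the rank.\<close>

lemma card_rank_class_kernels:
  assumes f: "f \<in> P"
  shows "|(\<lambda>g. pker (g |` ran a)) ` rank_class f| =o
    card_Stirling ( |ran a| +c cone) ( |ran f| +c cone)"
proof -
  let ?S = "ran a <+> {()}"
  \<comment> \<open>The block of the extra point exists even if \<open>g\<close> is defined on all
    of \<open>ran a\<close>, so the number of classes is always the rank plus one.\<close>
  define ext where "ext g = case_sum g (\<lambda>_ :: unit. None)" for g :: "'x \<rightharpoonup> 'y"
  define E where "E g = {(u, v). u \<in> ?S \<and> v \<in> ?S \<and> ext g u = ext g v}" for g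
  have "E ` rank_class f = {E. equiv ?S E \<and> |?S // E| =o |ran f <+> {()}| }" (is "_ = ?R")
  proof
    show "E ` rank_class f \<subseteq> ?R"
    proof (rule image_subsetI)
      fix g assume g: "g \<in> rank_class f"
      have "equiv ?S (E g)"
        by (auto simp: equiv_def refl_on_def sym_def trans_def E_def)
      moreover have "|?S // E g| =o |ran f <+> {()}|"
      proof -
        have ran_g: "ran (g |` ran a) = ran g"
          using g by (simp add: rank_class_def P_iff)
        have "ext g ` ?S = insert None (Some ` ran g)"
        proof
          show "ext g ` ?S \<subseteq> insert None (Some ` ran g)"
          proof (rule image_subsetI)
            fix u assume "u \<in> ?S"
            then show "ext g u \<in> insert None (Some ` ran g)"
              by (cases "ext g u") (auto simp: ext_def split: sum.splits intro: ranI)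
          qed
          show "insert None (Some ` ran g) \<subseteq> ext g ` ?S"
          proof
            fix o' assume "o' \<in> insert None (Some ` ran g)"
            then consider "o' = ext g (Inr ())" | y where "o' = Some y" "y \<in> ran g"
              by (auto simp: ext_def)
            then show "o' \<in> ext g ` ?S"
            proof cases
              case (2 y)
              then obtain x where "x \<in> ran a" "g x = Some y"
                using ran_g ran_restrict_iff[of y g "ran a"] by blast
              then have "o' = ext g (Inl x)" "Inl x \<in> ?S" using 2 by (auto simp: ext_def)
              then show ?thesis by blast
            qed auto
          qed
        qed
        moreover have "bij_betw (case_sum Some (\<lambda>_. None)) (ran g <+> {()}) (insert None (Some ` ran g))"
          by (rule bij_betw_byWitness[where f' = "case_option (Inr ()) Inl"]) auto
        ultimately have "|ran g <+> {()}| =o |ext g ` ?S|"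
          by (simp add: card_of_ordIsoI)
        from ordIso_symmetric[OF this] have 1: "|ext g ` ?S| =o |ran g <+> {()}|" .
        have 2: "|?S // E g| =o |ext g ` ?S|"
          unfolding E_def by (rule card_of_quotient_kernel)
        have 3: "|ran g <+> {()}| =o |ran f <+> {()}|"
          using g by (intro card_of_Plus_cong1) (simp add: rank_class_def)
        show ?thesis
          by (rule ordIso_transitive[OF 2 ordIso_transitive[OF 1 3]])
      qed
      ultimately show "E g \<in> ?R" by simp
    qed
    show "?R \<subseteq> E ` rank_class f"
    proof
      fix R assume "R \<in> ?R"
      then have eq: "equiv ?S R" and card: "|?S // R| =o |ran f <+> {()}|" by auto
      \<comment> \<open>\<open>c\<close> is the block of the extra point and has to become the
        undefined part, so the bijection of blocks with \<open>ran f <+> {()}\<close> is adjusted to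
        leave out \<open>c\<close> and \<open>Inr ()\<close> together.\<close>
      define c where "c = R `` {Inr ()}"
      obtain h where "bij_betw h (?S // R) (ran f <+> {()})"
        using card_of_ordIso[THEN iffD2, OF card] by blast
      moreover have "c \<in> ?S // R" by (auto simp: c_def quotient_def)
      ultimately obtain b where b: "bij_betw b (?S // R - {c}) ((ran f <+> {()}) - {Inr ()})"
        using bij_betw_remove[of h "?S // R" "ran f <+> {()}" c "Inr ()"] by auto
      define \<tau> :: "'y + unit \<Rightarrow> 'y" where "\<tau> = case_sum (\<lambda>y. y) undefined"
      have "bij_betw \<tau> ((ran f <+> {()}) - {Inr ()}) (ran f)"
        by (rule bij_betw_byWitness[where f' = Inl]) (auto simp: \<tau>_def)
      from bij_betw_trans[OF b this]
      have b': "bij_betw (\<tau> \<circ> b) (?S // R - {c}) (ran f)" .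
      define g where "g x = (if x \<in> ran a \<and> R `` {Inl x} \<noteq> c then Some ((\<tau> \<circ> b) (R `` {Inl x})) else None)" for x
      have cls: "R `` {u} \<in> ?S // R" if "u \<in> ?S" for u
        using that by (auto simp: quotient_def)
      have ran_g: "ran g = ran f"
      proof
        show "ran g \<subseteq> ran f"
        proof
          fix y assume "y \<in> ran g"
          then obtain x where x: "g x = Some y" by (auto simp: ran_def)
          then have "R `` {Inl x} \<in> ?S // R - {c}" "y = (\<tau> \<circ> b) (R `` {Inl x})"
            using cls[of "Inl x"] by (auto simp: g_def split: if_splits)
          then show "y \<in> ran f" using b' by (auto simp: bij_betw_def)
        qed
        show "ran f \<subseteq> ran g"
        proof
          fix y assume "y \<in> ran f"
          then obtain q where q: "q \<in> ?S // R - {c}" "y = (\<tau> \<circ> b) q"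
            using b' by (auto simp: bij_betw_def)
          then obtain u where u: "u \<in> ?S" "q = R `` {u}" by (auto simp: quotient_def)
          then obtain x where "x \<in> ran a" "u = Inl x"
            using q by (auto simp: c_def)
          with q u have "g x = Some y" by (auto simp: g_def)
          then show "y \<in> ran g" by (rule ranI)
        qed
      qed
      have dom_g: "dom g \<subseteq> ran a" by (auto simp: g_def split: if_splits)
      have "g \<in> rank_class f"
        using f ran_a_subset dom_g dom_subset_restrict[OF dom_g]
        by (auto simp: rank_class_def P_iff ran_g card_of_refl)
      moreover have "E g = R"
      proof -
        have ext: "ext g u = (if R `` {u} \<noteq> c then Some ((\<tau> \<circ> b) (R `` {u})) else None)" if "u \<in> ?S" for u
          using that by (elim PlusE) (simp_all add: ext_def g_def c_def)
        have inj: "inj_on (\<tau> \<circ> b) (?S // R - {c})" using b' by (simp add: bij_betw_def)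
        have "(if p \<noteq> c then Some ((\<tau> \<circ> b) p) else None) = (if q \<noteq> c then Some ((\<tau> \<circ> b) q) else None)
            \<longleftrightarrow> p = q" if "p \<in> ?S // R" "q \<in> ?S // R" for p q
          using inj_onD[OF inj, of p q] that by (cases "p = c"; cases "q = c") auto
        then have "ext g u = ext g v \<longleftrightarrow> (u, v) \<in> R" if "u \<in> ?S" "v \<in> ?S" for u v
          unfolding ext[OF that(1)] ext[OF that(2)]
          using cls[OF that(1)] cls[OF that(2)] eq_equiv_class_iff[OF eq that] by blast
        then have "(u, v) \<in> E g \<longleftrightarrow> (u, v) \<in> R" for u v
          unfolding E_def using equiv_type[OF eq] by blast
        then show ?thesis by (intro subset_antisym subrelI) blast+
      qed
      ultimately show "R \<in> E ` rank_class f" by blast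
    qed
  qed
  \<comment> \<open>\<open>E g\<close> and the restricted kernel determine each other: on
    \<open>ran a\<close> the block of the extra point is the complement of the domain.\<close>
  moreover have "|(\<lambda>g. pker (g |` ran a)) ` rank_class f| =o |E ` rank_class f|"
  proof (rule card_of_image_cong)
    fix g g' :: "'x \<rightharpoonup> 'y"
    have E_iff: "(Inl x, Inl x') \<in> E g \<longleftrightarrow> x \<in> ran a \<and> x' \<in> ran a \<and> g x = g x'"
      "(Inl x, Inr u) \<in> E g \<longleftrightarrow> x \<in> ran a \<and> g x = None" for x x' u and g :: "'x \<rightharpoonup> 'y"
      by (auto simp: E_def ext_def)
    show "pker (g |` ran a) = pker (g' |` ran a) \<longleftrightarrow> E g = E g'"
    proof
      assume ker: "pker (g |` ran a) = pker (g' |` ran a)"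
      have none: "g x = None \<longleftrightarrow> g' x = None" if "x \<in> ran a" for x
        using pker_eq_dom[OF ker] that by (metis domIff restrict_in)
      have eq: "g x = g x' \<longleftrightarrow> g' x = g' x'" if "x \<in> ran a" "x' \<in> ran a" for x x'
        using that pker_eqD[OF ker, of x x'] pker_eqD[OF ker[symmetric], of x x'] by auto
      have "(ext g u = ext g v) = (ext g' u = ext g' v)" if "u \<in> ?S" "v \<in> ?S" for u v
        using that none eq by (auto simp: ext_def eq_commute[of None])
      then show "E g = E g'" by (auto simp: E_def)
    next
      assume E: "E g = E g'"
      show "pker (g |` ran a) = pker (g' |` ran a)"
      proof (rule pker_eqI)
        have "x \<in> dom (g |` ran a) \<longleftrightarrow> x \<in> dom (g' |` ran a)" for x
          using E_iff(2)[of x "()" g] E_iff(2)[of x "()" g'] by (auto simp: E)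
        then show "dom (g |` ran a) = dom (g' |` ran a)" by blast
        fix x x' assume "x \<in> dom (g |` ran a)" "x' \<in> dom (g |` ran a)"
        then show "(g |` ran a) x = (g |` ran a) x' \<longleftrightarrow> (g' |` ran a) x = (g' |` ran a) x'"
          using E_iff(1)[of x x' g] E_iff(1)[of x x' g'] by (auto simp: E)
      qed
    qed
  qed
  ultimately show ?thesis
    by (simp add: card_Stirling_def csum_def cone_def Field_card_of)
qed

text \<open>The kernels are sorted by their restriction to \<open>ran a\<close>. Those with the same
  restriction as that of \<open>g\<close> are the kernels in \<open>Rhat_class g\<close>; normal
  forms count them, and their number depends only on the rank.\<close>

lemma card_pker_rank_class:
  assumes f: "f \<in> P"
  shows "|pker ` rank_class f| =o
    ( ( |ran f| +c cone) ^c |X - ran a| ) *c card_Stirling ( |ran a| +c cone) ( |ran f| +c cone)"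
proof -
  let ?\<kappa> = "( |ran f| +c cone) ^c |X - ran a|"
  define q where "q k = k \<inter> ran a \<times> ran a" for k :: "'x rel"
  have q: "q (pker g) = pker (g |` ran a)" for g :: "'x \<rightharpoonup> 'y"
    by (simp add: q_def pker_restrict)
  have "|pker ` rank_class f| =o ?\<kappa> *c |q ` pker ` rank_class f|"
  proof (rule card_of_const_fibres)
    show "Card_order ?\<kappa>" by (rule Card_order_cexp)
    fix k assume "k \<in> q ` pker ` rank_class f"
    then obtain g where g: "g \<in> rank_class f" and k: "k = pker (g |` ran a)"
      by (auto simp: q)
    then have gP: "g \<in> P" and card: "|ran g| =o |ran f|" by (auto simp: rank_class_def)
    have "h \<in> rank_class f" if h: "h \<in> Rhat_class g" for h
    proof -
      have hP: "h \<in> P" and "pker (h |` ran a) = pker (g |` ran a)"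
        using h by (auto simp: Rhat_class_def)
      then have "|ran h| =o |ran g|"
        using pker_eq_card_ran[of "h |` ran a" "g |` ran a"] gP by (simp add: P_ran_restrict)
      from ordIso_transitive[OF this card] hP show ?thesis
        by (simp add: rank_class_def)
    qed
    then have "{k' \<in> pker ` rank_class f. q k' = k} = pker ` Rhat_class g"
      by (auto simp: k q Rhat_class_def rank_class_def)
    also have "\<dots> = pker ` normal_forms g"
      by (rule pker_image_normal_forms[OF gP, symmetric])
    finally have "{k' \<in> pker ` rank_class f. q k' = k} = pker ` normal_forms g" .
    moreover have "( |ran g| +c cone) ^c |X - ran a| =o ?\<kappa>"
      by (intro cexp_cong1 csum_cong1 card card_of_Card_order)
    ultimately show "|{k' \<in> pker ` rank_class f. q k' = k}| =o ?\<kappa>"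
      using ordIso_transitive[OF card_pker_normal_forms[OF gP]] by simp
  qed
  also have "q ` pker ` rank_class f = (\<lambda>g. pker (g |` ran a)) ` rank_class f"
    by (simp add: image_image q)
  finally show ?thesis
    by (rule ordIso_transitive[OF _ cprod_cong2[OF card_rank_class_kernels[OF f]]])
qed

end

text \<open>A set \<open>Z\<close> on which \<open>a\<close> is defined and injective amounts to the
  set \<open>K\<close> of indices of the fibres it meets and one point in each. The predicate
  \<open>Q\<close> lets one bijection serve both a fixed index set and all index sets of a fixed
  size.\<close>

lemma bij_betw_transversals:
  fixes a :: "'y \<rightharpoonup> 'x" and ai :: "'i \<Rightarrow> 'x"
  assumes I: "inj_on ai I" "ran a = ai ` I"
  shows "bij_betw (\<lambda>(K, y). y ` K)
    (SIGMA K : {K. K \<subseteq> I \<and> Q K}. Pi\<^sub>E K (\<lambda>i. {y. a y = Some (ai i)}))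
    {Z. Z \<subseteq> dom a \<and> inj_on a Z \<and> Q {i \<in> I. Some (ai i) \<in> a ` Z}}"
  (is "bij_betw ?F ?S ?T")
proof -
  have idx: "{i \<in> I. Some (ai i) \<in> a ` y ` K} = K"
    if "K \<subseteq> I" "y \<in> Pi\<^sub>E K (\<lambda>i. {y. a y = Some (ai i)})" for K y
  proof -
    have "a (y k) = Some (ai k)" if "k \<in> K" for k
      using that \<open>y \<in> _\<close> by auto
    then have "a ` y ` K = (\<lambda>k. Some (ai k)) ` K"
      by (force simp: image_image)
    then show ?thesis
      using that(1) I(1) by (auto simp: inj_on_def)
  qed
  show ?thesis
  proof (rule bij_betw_imageI)
    show "inj_on ?F ?S"
    proof (rule inj_onI, clarify)
      fix K y K' y'
      assume K: "K \<subseteq> I" "y \<in> Pi\<^sub>E K (\<lambda>i. {y. a y = Some (ai i)})"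
        and K': "K' \<subseteq> I" "y' \<in> Pi\<^sub>E K' (\<lambda>i. {y. a y = Some (ai i)})" and eq: "y ` K = y' ` K'"
      have KK: "K = K'" using idx[OF K] idx[OF K'] eq by simp
      have "y k = y' k" if k: "k \<in> K" for k
      proof -
        obtain k' where k': "k' \<in> K'" "y k = y' k'" using k eq by blast
        then have "ai k = ai k'" using K K' k by (auto simp: PiE_iff)
        then have "k = k'" using I(1) K K' k k' by (auto dest: inj_onD)
        with k' show ?thesis by simp
      qed
      then show "K = K' \<and> y = y'"
        using KK K K' by (auto intro: PiE_ext)
    qed
    show "?F ` ?S = ?T"
    proof
      show "?F ` ?S \<subseteq> ?T"
      proof clarify
        fix K y assume K: "K \<subseteq> I" "y \<in> Pi\<^sub>E K (\<lambda>i. {y. a y = Some (ai i)})" and Q: "Q K"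
        have ay: "a (y k) = Some (ai k)" if "k \<in> K" for k
          using that K(2) by auto
        have "inj_on a (y ` K)"
        proof (rule inj_onI, clarify)
          fix k k' assume k: "k \<in> K" "k' \<in> K" "a (y k) = a (y k')"
          then have "k = k'"
            using ay[of k] ay[of k'] K(1) I(1) by (auto dest: inj_onD)
          then show "y k = y k'" by simp
        qed
        moreover have "y ` K \<subseteq> dom a" using ay by auto
        ultimately show "y ` K \<subseteq> dom a \<and> inj_on a (y ` K) \<and> Q {i \<in> I. Some (ai i) \<in> a ` y ` K}"
          using idx[OF K] Q by simp
      qed
      show "?T \<subseteq> ?F ` ?S"
      proof
        fix Z assume "Z \<in> ?T"
        then have Z: "Z \<subseteq> dom a" "inj_on a Z" and Q: "Q {i \<in> I. Some (ai i) \<in> a ` Z}" by auto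
        define K where "K = {i \<in> I. Some (ai i) \<in> a ` Z}"
        define y where "y = (\<lambda>i\<in>K. inv_into Z a (Some (ai i)))"
        have y: "y i \<in> Z" "a (y i) = Some (ai i)" if "i \<in> K" for i
          using that by (auto simp: y_def K_def intro: inv_into_into f_inv_into_f)
        have "z \<in> y ` K" if z: "z \<in> Z" for z
        proof -
          obtain x where x: "a z = Some x" using Z z by blast
          then have "x \<in> ai ` I" using I(2) by (auto intro: ranI)
          then obtain i where i: "i \<in> I" "x = ai i" by blast
          then have "i \<in> K" using x z by (force simp: K_def)
          moreover have "y i = z"
            using inj_onD[OF Z(2), of "y i" z] y[OF calculation] x i z by simp
          ultimately show ?thesis by blast
        qed
        then have "y ` K = Z" using y by blast
        moreover have "(K, y) \<in> ?S"
          using y Q by (auto simp: K_def[symmetric] y_def) (auto simp: K_def)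
        ultimately show "Z \<in> ?F ` ?S" by force
      qed
    qed
  qed
qed

section \<open>The partial transformation semigroup as a sandwich semigroup\<close>

lemma sandwich_PT_id: "sandwich_PT A A (Some |` A)"
  by unfold_locales (auto simp: PT_def ran_restrict_iff)

text \<open>For the identity on \<open>A\<close> the conditions in \<open>P_iff\<close> hold for
  every partial transformation, so the results on regular elements cover the whole of
  \<open>PT A A\<close>.\<close>

lemma RegPT_id: "RegPT A A (Some |` A) = PT A A"
proof -
  interpret S: sandwich_PT A A "Some |` A" by (rule sandwich_PT_id)
  have ran: "ran (Some |` A) = A"
    by (auto simp: set_eq_iff ran_restrict_iff)
  show ?thesis
  proof
    show "RegPT A A (Some |` A) \<subseteq> PT A A"
      by (auto simp: RegPT_def regular_elements_def)
    show "PT A A \<subseteq> RegPT A A (Some |` A)"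
    proof
      fix f assume f: "f \<in> PT A A"
      have "inj_on (Some |` A) A"
        by (simp add: inj_on_def)
      then have "inj_on (Some |` A) (ran f)" "f |` A = f"
        using f by (auto simp: PT_def intro: inj_on_subset dom_subset_restrict)
      with f show "f \<in> RegPT A A (Some |` A)"
        unfolding S.P_iff ran by (simp add: PT_def)
    qed
  qed
qed

lemma sandwich_id: "f \<in> PT A A \<Longrightarrow> sandwich (Some |` A) f g = pcomp f g"
  by (rule map_eqI) (force simp: sandwich_Some_iff pcomp_Some_iff PT_def restrict_map_def ran_def)

lemma green_PT_id:
  "greenR (PT A A) pcomp = greenR (RegPT A A (Some |` A)) (sandwich (Some |` A))"
  "greenL (PT A A) pcomp = greenL (RegPT A A (Some |` A)) (sandwich (Some |` A))"
  "greenH (PT A A) pcomp = greenH (RegPT A A (Some |` A)) (sandwich (Some |` A))"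
  "greenD (PT A A) pcomp = greenD (RegPT A A (Some |` A)) (sandwich (Some |` A))"
  unfolding RegPT_id by (rule green_cong; simp add: sandwich_id)+

lemma green_PT_iff:
  "(f, g) \<in> greenR (PT A A) pcomp \<longleftrightarrow> f \<in> PT A A \<and> g \<in> PT A A \<and> pker f = pker g"
  "(f, g) \<in> greenL (PT A A) pcomp \<longleftrightarrow> f \<in> PT A A \<and> g \<in> PT A A \<and> ran f = ran g"
  "(f, g) \<in> greenH (PT A A) pcomp \<longleftrightarrow> f \<in> PT A A \<and> g \<in> PT A A \<and> pker f = pker g \<and> ran f = ran g"
  "(f, g) \<in> greenD (PT A A) pcomp \<longleftrightarrow> f \<in> PT A A \<and> g \<in> PT A A \<and> |ran f| =o |ran g|"
proof -
  interpret S: sandwich_PT A A "Some |` A" by (rule sandwich_PT_id)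
  show "(f, g) \<in> greenR (PT A A) pcomp \<longleftrightarrow> f \<in> PT A A \<and> g \<in> PT A A \<and> pker f = pker g"
    "(f, g) \<in> greenL (PT A A) pcomp \<longleftrightarrow> f \<in> PT A A \<and> g \<in> PT A A \<and> ran f = ran g"
    "(f, g) \<in> greenH (PT A A) pcomp \<longleftrightarrow> f \<in> PT A A \<and> g \<in> PT A A \<and> pker f = pker g \<and> ran f = ran g"
    "(f, g) \<in> greenD (PT A A) pcomp \<longleftrightarrow> f \<in> PT A A \<and> g \<in> PT A A \<and> |ran f| =o |ran g|"
    by (simp_all only: green_PT_id[unfolded RegPT_id] S.greenR_iff[unfolded RegPT_id]
        S.greenL_iff[unfolded RegPT_id] S.greenH_iff[unfolded RegPT_id] S.greenD_iff[unfolded RegPT_id])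
qed

section \<open>The homomorphism \<open>bar\<close> and the classes pulled back along it\<close>

context sandwich_PT begin

lemma bar_in_PT: "bar a f \<in> PT (ran a) (ran a)"
  by (auto simp: PT_def bar_Some_iff ran_def)

text \<open>The form as a relabelling, injective by \<open>inj_on_the_a\<close>, lets kernel and
  rank pass from \<open>f\<close> on \<open>ran a\<close> to \<open>bar a f\<close>.\<close>

lemma bar_eq:
  assumes f: "f \<in> P"
  shows "bar a f = map_option (\<lambda>y. the (a y)) \<circ> (f |` ran a)"
proof
  fix x
  show "bar a f x = (map_option (\<lambda>y. the (a y)) \<circ> (f |` ran a)) x"
  proof (cases "(f |` ran a) x")
    case None
    then have "bar a f x \<noteq> Some z" for z
      by (auto simp: bar_Some_iff)
    with None show ?thesis by (cases "bar a f x") auto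
  next
    case (Some y)
    then have "x \<in> ran a" "f x = Some y" by (auto simp: restrict_map_def split: if_splits)
    moreover from this obtain w where "a y = Some w"
      using f by (auto simp: P_iff intro: ranI)
    ultimately have "bar a f x = Some w" by (auto simp: bar_Some_iff)
    with Some \<open>a y = Some w\<close> show ?thesis by simp
  qed
qed

lemma inj_on_the_a: "f \<in> P \<Longrightarrow> inj_on (\<lambda>y. the (a y)) (ran f)"
proof (rule inj_onI)
  fix y y' assume f: "f \<in> P" and y: "y \<in> ran f" "y' \<in> ran f" and eq: "the (a y) = the (a y')"
  then have "a y = a y'" by (metis P_iff domIff option.expand subsetD)
  then show "y = y'" using f y by (auto simp: P_iff dest: inj_onD)
qed

lemma pker_bar: "f \<in> P \<Longrightarrow> pker (bar a f) = pker (f |` ran a)"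
  by (simp add: bar_eq pker_map_option P_ran_restrict inj_on_the_a)

lemma ran_bar: "f \<in> P \<Longrightarrow> ran (bar a f) = (\<lambda>y. the (a y)) ` ran f"
  by (simp add: bar_eq ran_map_option_comp P_ran_restrict)

lemma Some_ran_bar: "f \<in> P \<Longrightarrow> Some ` ran (bar a f) = a ` ran f"
proof -
  assume f: "f \<in> P"
  then have "Some (the (a y)) = a y" if "y \<in> ran f" for y
    using that by (auto simp: P_iff)
  with f show ?thesis by (simp add: ran_bar image_image)
qed

lemma ran_bar_eq_iff:
  assumes "f \<in> P" "g \<in> P"
  shows "ran (bar a f) = ran (bar a g) \<longleftrightarrow> a ` ran f = a ` ran g"
  using Some_ran_bar[OF assms(1)] Some_ran_bar[OF assms(2)] inj_image_eq_iff[OF inj_Some] by metis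

lemma card_ran_bar: "f \<in> P \<Longrightarrow> |ran (bar a f)| =o |ran f|"
  unfolding ran_bar
  by (rule ordIso_symmetric[OF card_of_ordIsoI[OF inj_on_imp_bij_betw[OF inj_on_the_a]]])

lemma hat_classes:
  assumes f: "f \<in> P"
  shows "hat P a (greenR (PT (ran a) (ran a)) pcomp) `` {f} = Rhat_class f"
    "hat P a (greenL (PT (ran a) (ran a)) pcomp) `` {f} = Lhat_class f"
    "hat P a (greenH (PT (ran a) (ran a)) pcomp) `` {f} = Hhat_class f"
    "hat P a (greenD (PT (ran a) (ran a)) pcomp) `` {f} = rank_class f"
proof -
  show R: "hat P a (greenR (PT (ran a) (ran a)) pcomp) `` {f} = Rhat_class f"
    using f bar_in_PT by (auto simp: hat_def green_PT_iff pker_bar Rhat_class_def)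
  show L: "hat P a (greenL (PT (ran a) (ran a)) pcomp) `` {f} = Lhat_class f"
  proof (rule Set.set_eqI)
    fix g show "g \<in> hat P a (greenL (PT (ran a) (ran a)) pcomp) `` {f} \<longleftrightarrow> g \<in> Lhat_class f"
      using f bar_in_PT
      by (cases "g \<in> P") (simp_all add: hat_def green_PT_iff Lhat_class_def ran_bar_eq_iff
          eq_commute[of "a ` ran f" "a ` ran g"])
  qed
  show "hat P a (greenH (PT (ran a) (ran a)) pcomp) `` {f} = Hhat_class f"
    unfolding Hhat_class_def R[symmetric] L[symmetric] by (auto simp: hat_def greenH_def)
  have "|ran (bar a f)| =o |ran (bar a g)| \<longleftrightarrow> |ran g| =o |ran f|" if g: "g \<in> P" for g
  proof
    assume "|ran (bar a f)| =o |ran (bar a g)|"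
    from ordIso_transitive[OF this card_ran_bar[OF g]]
    have "|ran f| =o |ran g|"
      by (rule ordIso_transitive[OF ordIso_symmetric[OF card_ran_bar[OF f]]])
    then show "|ran g| =o |ran f|" by (rule ordIso_symmetric)
  next
    assume "|ran g| =o |ran f|"
    from ordIso_transitive[OF card_ran_bar[OF f] ordIso_symmetric[OF this]]
    show "|ran (bar a f)| =o |ran (bar a g)|"
      by (rule ordIso_transitive[OF _ ordIso_symmetric[OF card_ran_bar[OF g]]])
  qed
  then show "hat P a (greenD (PT (ran a) (ran a)) pcomp) `` {f} = rank_class f"
    using f bar_in_PT by (auto simp: hat_def green_PT_iff rank_class_def)
qed

lemma greenD_class: "f \<in> P \<Longrightarrow> greenD P (\<star>) `` {f} = rank_class f"
  by (auto simp: greenD_iff rank_class_def intro: ordIso_symmetric)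

text \<open>All values of \<open>f\<close> are attained on \<open>ran a\<close>, so
  \<open>bar a f\<close> has the same image as the unrestricted \<open>pcomp f a\<close>, as
  \<open>idempotent_imp_permuted\<close> demands.\<close>

lemma bar_idempotent_imp_permuted:
  assumes f: "f \<in> P" and e: "(bar a f, e) \<in> greenH (PT (ran a) (ran a)) pcomp" "pcomp e e = e"
  shows "\<exists>\<phi>. permuted_by f \<phi>"
proof -
  have e': "e \<in> PT (ran a) (ran a)" "pker e = pker (f |` ran a)" "ran e = ran (bar a f)"
    using e(1) f by (auto simp: green_PT_iff pker_bar)
  have "ran (pcomp f a) = ran (bar a f)"
  proof
    show "ran (pcomp f a) \<subseteq> ran (bar a f)"
    proof
      fix x assume "x \<in> ran (pcomp f a)"
      then obtain v y where v: "f v = Some y" "a y = Some x"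
        by (auto simp: ran_def pcomp_Some_iff)
      then have "x = the (a y)" "y \<in> ran f" by (auto intro: ranI)
      then show "x \<in> ran (bar a f)" using f by (simp add: ran_bar)
    qed
    show "ran (bar a f) \<subseteq> ran (pcomp f a)"
      by (auto simp: ran_def bar_Some_iff pcomp_Some_iff)
  qed
  with e' e(2) show ?thesis
    by (intro idempotent_imp_permuted[OF f, of e]) (simp_all add: PT_def)
qed

lemma bar_group_imp_permuted:
  assumes f: "f \<in> P" and G: "is_group_on (greenH (PT (ran a) (ran a)) pcomp `` {bar a f}) pcomp"
  shows "\<exists>\<phi>. permuted_by f \<phi>"
  using is_group_on_idempotent[OF G] bar_idempotent_imp_permuted[OF f] by blast

text \<open>\<open>bar\<close> sends the identity of \<open>K\<close> to an idempotent in the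
  \<H>-class of \<open>bar a f\<close>. The group case, applied inside \<open>PT A A\<close> with
  the identity as sandwich element, makes that class a group; (iv) is the contrapositive.\<close>

lemma Hclass_group_imp_bar_group:
  assumes f: "f \<in> P" and K: "K \<subseteq> Hhat_class f" and G: "is_group_on K (\<star>)"
  shows "is_group_on (greenH (PT (ran a) (ran a)) pcomp `` {bar a f}) pcomp"
proof -
  interpret B: sandwich_PT "ran a" "ran a" "Some |` ran a" by (rule sandwich_PT_id)
  let ?H = "greenH (PT (ran a) (ran a)) pcomp `` {bar a f}"
  have ran_id: "ran (Some |` ran a) = ran a"
    by (auto simp: set_eq_iff ran_restrict_iff)
  have fB: "bar a f \<in> B.P"
    by (simp add: RegPT_id bar_in_PT)
  obtain e where e: "e \<in> K" "e \<star> e = e"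
    using is_group_on_idempotent[OF G] by blast
  have "e \<in> hat P a (greenH (PT (ran a) (ran a)) pcomp) `` {f}"
    using e(1) K hat_classes(3)[OF f] by blast
  then have "(bar a f, bar a e) \<in> greenH (PT (ran a) (ran a)) pcomp"
    by (simp add: hat_def)
  moreover have "pcomp (bar a e) (bar a e) = bar a e"
    using e(2) bar_sandwich[of a e e] by simp
  \<comment> \<open>\<open>bar\<close> for the identity leaves \<open>bar a f\<close> unchanged, so
    the criterion applied in \<open>PT A A\<close> speaks of the same \<H>-class.\<close>
  moreover have "bar (Some |` ran a) (bar a f) = bar a f"
    by (rule map_eqI) (auto simp: bar_Some_iff ran_id restrict_map_def split: if_splits intro: ranI)
  ultimately obtain \<phi> where \<phi>: "B.permuted_by (bar a f) \<phi>"
    using B.bar_idempotent_imp_permuted[OF fB, of "bar a e"] by (auto simp: ran_id)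
  have H: "?H \<in> B.P // greenH B.P (sandwich (Some |` ran a))"
    using fB unfolding green_PT_id(3) by (rule quotientI)
  have "?H \<subseteq> B.Hhat_class (bar a f)"
  proof
    fix h assume "h \<in> ?H"
    then have h: "h \<in> PT (ran a) (ran a)" "pker (bar a f) = pker h" "ran (bar a f) = ran h"
      by (auto simp: green_PT_iff)
    moreover have "h |` ran a = h" "bar a f |` ran a = bar a f"
      using h(1) bar_in_PT by (auto simp: PT_def intro!: dom_subset_restrict)
    ultimately show "h \<in> B.Hhat_class (bar a f)"
      by (simp add: B.Hhat_class_def B.Rhat_class_def B.Lhat_class_def ran_id RegPT_id)
  qed
  from B.Hclass_group[OF fB \<phi> H this]
  have "is_group_on ?H (sandwich (Some |` ran a))"
    by (auto simp: is_group_iso_to_def is_group_on_def)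
  then show ?thesis
  proof (rule is_group_on_cong)
    fix x y assume "x \<in> ?H"
    then have "x \<in> PT (ran a) (ran a)" by (auto simp: greenH_def greenR_def)
    then show "sandwich (Some |` ran a) x y = pcomp x y" by (rule sandwich_id)
  qed
qed

text \<open>For subsets of \<open>dom a\<close>, having the same image under \<open>a\<close> as
  \<open>ran f\<close> means meeting the same fibres; the index set is thus fixed and only the
  choice of points remains.\<close>

lemma card_transversals:
  assumes I: "inj_on ai I" "ran a = ai ` I" and f: "f \<in> P"
  shows "|transversals f| =o |Pi\<^sub>E {i \<in> I. Some (ai i) \<in> a ` ran f} (\<lambda>i. {y. a y = Some (ai i)})|"
proof -
  let ?J = "{i \<in> I. Some (ai i) \<in> a ` ran f}" and ?A = "\<lambda>i. {y. a y = Some (ai i)}"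
  have sub: "a ` Z \<subseteq> a ` Z'" if ZZ: "Z \<subseteq> dom a" "{i \<in> I. Some (ai i) \<in> a ` Z} \<subseteq> {i \<in> I. Some (ai i) \<in> a ` Z'}" for Z Z'
  proof (rule image_subsetI)
    fix z assume z: "z \<in> Z"
    then obtain i where i: "i \<in> I" "a z = Some (ai i)"
      using ZZ(1) I(2) by (force intro: ranI)
    then have "Some (ai i) \<in> a ` Z" using z by (intro image_eqI[of _ _ z]) simp_all
    with i ZZ(2) show "a z \<in> a ` Z'" by auto
  qed
  have "ran f \<subseteq> dom a" using f by (simp add: P_iff)
  then have eq: "a ` Z = a ` ran f \<longleftrightarrow> {i \<in> I. Some (ai i) \<in> a ` Z} = ?J" if "Z \<subseteq> dom a" for Z
    using subset_antisym[OF sub[of Z "ran f"] sub[of "ran f" Z]] that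
    by (intro iffI) simp_all
  have T: "transversals f = {Z. Z \<subseteq> dom a \<and> inj_on a Z \<and> {i \<in> I. Some (ai i) \<in> a ` Z} = ?J}"
    unfolding transversals_def by (intro Collect_cong conj_cong refl eq)
  have "{K. K \<subseteq> I \<and> K = ?J} = {?J}" by blast
  then have 1: "bij_betw (\<lambda>(K, y). y ` K) (SIGMA K : {?J}. Pi\<^sub>E K ?A) (transversals f)"
    using bij_betw_transversals[OF I, of "\<lambda>K. K = ?J"] by (simp add: T)
  have 2: "bij_betw snd (SIGMA K : {J}. Pi\<^sub>E K ?A) (Pi\<^sub>E J ?A)" for J
    by (rule bij_betw_byWitness[where f' = "Pair J"]) auto
  show ?thesis
    by (rule ordIso_transitive[OF ordIso_symmetric[OF card_of_ordIsoI[OF 1]] card_of_ordIsoI[OF 2]])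
qed

text \<open>As \<open>a\<close> is injective on \<open>Z\<close>, the size of \<open>Z\<close> is
  the number of fibres it meets, so the condition on the rank becomes one on the index set.\<close>

lemma card_ran_rank_class:
  assumes I: "inj_on ai I" "ran a = ai ` I" and f: "f \<in> P"
  shows "|ran ` rank_class f| =o
    |SIGMA K : {K. K \<subseteq> I \<and> |K| =o |ran f| }. Pi\<^sub>E K (\<lambda>i. {y. a y = Some (ai i)})|"
proof -
  have card: "|{i \<in> I. Some (ai i) \<in> a ` Z}| =o |Z|" if Z: "Z \<subseteq> dom a" "inj_on a Z" for Z
  proof -
    let ?J = "{i \<in> I. Some (ai i) \<in> a ` Z}"
    have "bij_betw (\<lambda>i. Some (ai i)) ?J (a ` Z)"
    proof (rule bij_betw_imageI)
      show "inj_on (\<lambda>i. Some (ai i)) ?J" using I(1) by (auto simp: inj_on_def)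
      have "a z \<in> (\<lambda>i. Some (ai i)) ` ?J" if z: "z \<in> Z" for z
      proof -
        obtain i where i: "i \<in> I" "a z = Some (ai i)"
          using z Z(1) I(2) by (force intro: ranI)
        then have "Some (ai i) \<in> a ` Z" using z by (intro image_eqI[of _ _ z]) simp_all
        with i show ?thesis by (intro image_eqI[of _ _ i]) simp_all
      qed
      then show "(\<lambda>i. Some (ai i)) ` ?J = a ` Z" by auto
    qed
    moreover have "bij_betw a Z (a ` Z)" using Z(2) by (rule inj_on_imp_bij_betw)
    ultimately show ?thesis
      by (rule ordIso_transitive[OF card_of_ordIsoI ordIso_symmetric[OF card_of_ordIsoI]])
  qed
  have "|Z| =o |ran f| \<longleftrightarrow> |{i \<in> I. Some (ai i) \<in> a ` Z}| =o |ran f|"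
    if "Z \<subseteq> dom a" "inj_on a Z" for Z
    by (rule iffI) (erule ordIso_transitive[OF card[OF that]]
        ordIso_transitive[OF ordIso_symmetric[OF card[OF that]]])+
  then have "ran ` rank_class f =
      {Z. Z \<subseteq> dom a \<and> inj_on a Z \<and> |{i \<in> I. Some (ai i) \<in> a ` Z}| =o |ran f| }"
    unfolding ran_image_rank_class[OF f] by blast
  then show ?thesis
    using ordIso_symmetric[OF card_of_ordIsoI[OF bij_betw_transversals[OF I, of "\<lambda>K. |K| =o |ran f|"]]]
    by simp
qed

section \<open>Counting the classes\<close>

lemma union_of_R_classes:
  assumes f: "f \<in> P"
  shows "union_of_classes P (( |ran f| +c cone) ^c |X - ran a| ) (greenR P (\<star>)) (Rhat_class f)"
proof (rule union_of_classes_kernel[where k = pker])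
  show "greenR P (\<star>) = {(x, y). x \<in> P \<and> y \<in> P \<and> pker x = pker y}"
    by (auto simp: greenR_iff)
  show "Rhat_class f \<subseteq> P" by (auto simp: Rhat_class_def)
  show "y \<in> Rhat_class f" if "x \<in> Rhat_class f" "y \<in> P" "pker x = pker y" for x y
    using that by (simp add: Rhat_class_def pker_restrict)
  show "|pker ` Rhat_class f| =o ( |ran f| +c cone) ^c |X - ran a|"
    unfolding pker_image_normal_forms[OF f, symmetric]
    by (rule card_pker_normal_forms[OF f])
qed

lemma union_of_L_classes:
  assumes f: "f \<in> P" and l: "|transversals f| =o l"
  shows "union_of_classes P l (greenL P (\<star>)) (Lhat_class f)"
proof (rule union_of_classes_kernel[where k = ran])
  show "greenL P (\<star>) = {(x, y). x \<in> P \<and> y \<in> P \<and> ran x = ran y}"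
    by (auto simp: greenL_iff)
  show "Lhat_class f \<subseteq> P" by (auto simp: Lhat_class_def)
  show "y \<in> Lhat_class f" if "x \<in> Lhat_class f" "y \<in> P" "ran x = ran y" for x y
    using that by (simp add: Lhat_class_def)
  show "|ran ` Lhat_class f| =o l"
    by (simp only: ran_image_Lhat_class[OF f] l)
qed


text \<open>The pairs of kernel and image fill a rectangle, so the count is a product; this serves
  both \<open>Hhat_class f\<close> and \<open>rank_class f\<close>.\<close>

lemma union_of_H_classes:
  assumes B: "B \<subseteq> P"
    and saturated: "\<And>x y. x \<in> B \<Longrightarrow> y \<in> P \<Longrightarrow> pker x = pker y \<Longrightarrow> ran x = ran y \<Longrightarrow> y \<in> B"
    and im: "(\<lambda>g. (pker g, ran g)) ` B = U \<times> V"
    and U: "|U| =o r" and V: "|V| =o l"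
  shows "union_of_classes P (r *c l) (greenH P (\<star>)) B"
proof (rule union_of_classes_kernel[where k = "\<lambda>g. (pker g, ran g)"])
  show "greenH P (\<star>) = {(x, y). x \<in> P \<and> y \<in> P \<and> (pker x, ran x) = (pker y, ran y)}"
    by (auto simp: greenH_iff)
  have "|U| *c |V| =o r *c l" using U V by (rule cprod_cong)
  then show "|(\<lambda>g. (pker g, ran g)) ` B| =o r *c l"
    by (simp add: im cprod_def Field_card_of)
qed (use B saturated in auto)

end

theorem theorem2p35:
  fixes X :: "'x set" and Y :: "'y set" and a :: "'y \<rightharpoonup> 'x"
    and I :: "'i set" and ai :: "'i \<Rightarrow> 'x"
    and A :: "'x set" and Ai :: "'i \<Rightarrow> 'y set" and lam :: "'i \<Rightarrow> 'y rel"
    and Lam :: "'i set \<Rightarrow> ('i \<Rightarrow> 'y) rel"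
    and \<alpha> \<beta> :: "'x rel" and \<mu> :: "'y rel"
    and P :: "('x \<rightharpoonup> 'y) set" and f :: "'x \<rightharpoonup> 'y"
    and Ra La Ha Da Rhat Lhat Hhat Dhat :: "('x \<rightharpoonup> 'y) rel"
  assumes a: "a \<in> PT Y X"
    and A: "A = ran a"
    and I: "inj_on ai I" "A = ai ` I"
    and Ai: "Ai = (\<lambda>i. {y. a y = Some (ai i)})"
    and lam: "lam = (\<lambda>i. |Ai i| )"
    and Lam: "Lam = (\<lambda>K. card_Prod K lam)"
    and alpha: "\<alpha> = prank a"
    and beta: "\<beta> = |X - ran a|"
    and P: "P = RegPT X Y a"
    and green: "Ra = greenR P (sandwich a)" "La = greenL P (sandwich a)"
      "Ha = greenH P (sandwich a)" "Da = greenD P (sandwich a)"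
    and hats: "Rhat = hat P a (greenR (PT A A) pcomp)" "Lhat = hat P a (greenL (PT A A) pcomp)"
      "Hhat = hat P a (greenH (PT A A) pcomp)" "Dhat = hat P a (greenD (PT A A) pcomp)"
    and f: "f \<in> P"
    and mu: "\<mu> = prank f"
  shows
    "(\<exists>F y. tabular f {i \<in> I. ran f \<inter> Ai i \<noteq> {}} F y \<and>
        (\<forall>j \<in> {i \<in> I. ran f \<inter> Ai i \<noteq> {}}. y j \<in> Ai j)) \<and>
     (\<forall>J F y. J \<subseteq> I \<longrightarrow> tabular f J F y \<longrightarrow> (\<forall>j\<in>J. y j \<in> Ai j) \<longrightarrow>
        union_of_classes P ((\<mu> +c cone) ^c \<beta>) Ra (Rhat `` {f}) \<and>
        union_of_classes P (Lam J) La (Lhat `` {f}) \<and>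
        (union_of_classes P (((\<mu> +c cone) ^c \<beta>) *c Lam J) Ha (Hhat `` {f}) \<and>
          (\<forall>K \<in> P // Ha. K \<subseteq> Hhat `` {f} \<longrightarrow> |K| =o card_fact \<mu>)) \<and>
        (\<not> is_group_on (greenH (PT A A) pcomp `` {bar a f}) pcomp \<longrightarrow>
          (\<forall>K \<in> P // Ha. K \<subseteq> Hhat `` {f} \<longrightarrow> \<not> is_group_on K (sandwich a))) \<and>
        (is_group_on (greenH (PT A A) pcomp `` {bar a f}) pcomp \<longrightarrow>
          (\<forall>K \<in> P // Ha. K \<subseteq> Hhat `` {f} \<longrightarrow>
             is_group_iso_to K (sandwich a) (symmetric_group \<mu>)) \<and>
          rectangular_group (Hhat `` {f}) (sandwich a)
            ((\<mu> +c cone) ^c \<beta>) (Lam J) (symmetric_group \<mu>)) \<and>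
        (Dhat `` {f} = Da `` {f} \<and> Da `` {f} = {g \<in> P. prank g =o \<mu>} \<and>
          union_of_classes P (((\<mu> +c cone) ^c \<beta>) *c card_Stirling (\<alpha> +c cone) (\<mu> +c cone))
            Ra (Dhat `` {f}) \<and>
          union_of_classes P (BNF_Cardinal_Arithmetic.Csum |{K. K \<subseteq> I \<and> |K| =o \<mu>}| Lam) La (Dhat `` {f}) \<and>
          union_of_classes P
            ((((\<mu> +c cone) ^c \<beta>) *c card_Stirling (\<alpha> +c cone) (\<mu> +c cone)) *c
               BNF_Cardinal_Arithmetic.Csum |{K. K \<subseteq> I \<and> |K| =o \<mu>}| Lam)
            Ha (Dhat `` {f})))"
proof -
  interpret sandwich_PT X Y a by unfold_locales (rule a)
  have fP: "f \<in> RegPT X Y a" using f P by simp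
  have aI: "ran a = ai ` I" using A I(2) by simp
  let ?\<rho> = "(\<mu> +c cone) ^c \<beta>"
  have \<rho>: "?\<rho> = ( |ran f| +c cone) ^c |X - ran a|"
    by (simp add: mu beta prank_def)
  have f_af: "\<exists>i\<in>I. y \<in> Ai i" if "y \<in> ran f" for y
  proof -
    have "y \<in> dom a" using that fP by (auto simp: P_iff)
    then obtain x where x: "a y = Some x" by blast
    then have "x \<in> ai ` I" using aI by (auto intro: ranI)
    with x show ?thesis by (auto simp: Ai)
  qed
  have Ai_unique: "i = j" if "y \<in> Ai i" "y \<in> Ai j" "i \<in> I" "j \<in> I" for i j y
    using that I(1) by (auto simp: Ai dest: inj_onD)
  have tab: "\<exists>F y. tabular f {i \<in> I. ran f \<inter> Ai i \<noteq> {}} F y \<and>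
        (\<forall>j \<in> {i \<in> I. ran f \<inter> Ai i \<noteq> {}}. y j \<in> Ai j)"
  proof -
    let ?J = "{i \<in> I. ran f \<inter> Ai i \<noteq> {}}"
    have "\<forall>j\<in>?J. \<exists>y. y \<in> ran f \<inter> Ai j" by blast
    from bchoice[OF this] obtain y where y: "y j \<in> ran f \<inter> Ai j" if "j \<in> ?J" for j
      by blast
    \<comment> \<open>\<open>a\<close> is injective on \<open>ran f\<close>, so each fibre holds at
      most one value of \<open>f\<close> and the chosen points exhaust \<open>ran f\<close>.\<close>
    have "z \<in> y ` ?J" if z: "z \<in> ran f" for z
    proof -
      obtain i where i: "i \<in> I" "z \<in> Ai i" using f_af[OF z] by blast
      then have iJ: "i \<in> ?J" using z by blast
      have "a z = a (y i)" using i(2) y[OF iJ] by (auto simp: Ai)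
      then have "z = y i" using z y[OF iJ] fP by (auto simp: P_iff dest: inj_onD)
      with iJ show ?thesis by blast
    qed
    then have ran: "ran f = y ` ?J" using y by blast
    moreover have "inj_on y ?J"
    proof (rule inj_onI)
      fix j k assume jk: "j \<in> ?J" "k \<in> ?J" "y j = y k"
      with y[OF jk(1)] y[OF jk(2)] show "j = k" by (intro Ai_unique[of "y j"]) auto
    qed
    moreover have "dom f = (\<Union>j\<in>?J. {x. f x = Some (y j)})"
    proof
      show "dom f \<subseteq> (\<Union>j\<in>?J. {x. f x = Some (y j)})"
      proof
        fix x assume "x \<in> dom f"
        then obtain z where z: "f x = Some z" by blast
        then have "z \<in> y ` ?J" using ran by (auto intro: ranI)
        with z show "x \<in> (\<Union>j\<in>?J. {x. f x = Some (y j)})" by blast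
      qed
    qed blast
    ultimately have "tabular f ?J (\<lambda>j. {x. f x = Some (y j)}) y"
      unfolding tabular_def by blast
    with y show ?thesis by blast
  qed
  show ?thesis
  proof (rule conjI[OF tab], intro allI impI)
    fix J F y
    assume J: "J \<subseteq> I" and "tabular f J F y" and y: "\<forall>j\<in>J. y j \<in> Ai j"
    then have ran: "ran f = y ` J" by (simp add: tabular_def)
    have "a ` ran f = (\<lambda>j. Some (ai j)) ` J"
      unfolding ran image_image by (rule image_cong) (use y in \<open>auto simp: Ai\<close>)
    \<comment> \<open>The tabular form forces \<open>J\<close> to index exactly the fibres that
      \<open>ran f\<close> meets, so the count of transversals applies to the given
      \<open>J\<close>.\<close>
    then have J_eq: "{i \<in> I. Some (ai i) \<in> a ` ran f} = J"
      using J I(1) by (auto simp: inj_on_def)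
    have LamK: "Lam K = |Pi\<^sub>E K (\<lambda>i. {y. a y = Some (ai i)})|" for K
      by (simp add: Lam card_Prod_def lam Ai Field_card_of)
    have T: "|transversals f| =o Lam J"
      using card_transversals[OF I(1) aI fP] by (simp add: J_eq LamK)
    have LamC: "Card_order (Lam J)" by (simp add: LamK card_of_Card_order)
    \<comment> \<open>The field of \<open>|ran f|\<close> is \<open>ran f\<close> itself, so the
      symmetric group on \<open>\<mu>\<close> is literally the permutation group of
      \<open>ran f\<close>.\<close>
    have G: "symmetric_group \<mu> = BijGroup (ran f)"
      by (simp add: symmetric_group_def mu prank_def Field_card_of)
    note hats' = hat_classes[OF fP, folded A P, folded hats]
    note green' = green[unfolded P]
    let ?\<Sigma> = "BNF_Cardinal_Arithmetic.Csum |{K. K \<subseteq> I \<and> |K| =o \<mu>}| Lam"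
    let ?\<sigma> = "?\<rho> *c card_Stirling (\<alpha> +c cone) (\<mu> +c cone)"
    have rk_L: "|ran ` rank_class f| =o ?\<Sigma>"
      using card_ran_rank_class[OF I(1) aI fP]
      by (simp add: Csum_def Field_card_of LamK mu prank_def)
    have rk_R: "|pker ` rank_class f| =o ?\<sigma>"
      using card_pker_rank_class[OF fP] by (simp add: alpha beta mu prank_def)
    have Dclass: "rank_class f = {g \<in> P. prank g =o \<mu>}"
      by (simp add: rank_class_def P prank_def mu)
    have HK: "\<exists>n\<in>normal_forms f. \<exists>Z\<in>transversals f. bij_betw (\<lambda>s. assemble (s, n, Z)) (Bij (ran f)) K"
      if "K \<in> P // Ha" "K \<subseteq> Hhat_class f" for K
      using Hhat_class_Hclass[OF fP] that by (simp add: P green)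
    have i: "union_of_classes P ?\<rho> Ra (Rhat `` {f})"
      unfolding hats' green' P \<rho> by (rule union_of_R_classes[OF fP])
    have ii: "union_of_classes P (Lam J) La (Lhat `` {f})"
      unfolding hats' green' P by (rule union_of_L_classes[OF fP T])
    have iii: "union_of_classes P (?\<rho> *c Lam J) Ha (Hhat `` {f})"
      unfolding hats' green' P \<rho>
    proof (rule union_of_H_classes[OF _ _ pker_ran_image_Hhat_class[OF fP] card_pker_normal_forms[OF fP] T])
      show "Hhat_class f \<subseteq> RegPT X Y a" by (auto simp: Hhat_class_def Rhat_class_def)
      show "y \<in> Hhat_class f" if "x \<in> Hhat_class f" "y \<in> RegPT X Y a" "pker x = pker y" "ran x = ran y" for x y
        using that by (simp add: Hhat_class_def Rhat_class_def Lhat_class_def pker_restrict)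
    qed
    have iii': "\<forall>K \<in> P // Ha. K \<subseteq> Hhat `` {f} \<longrightarrow> |K| =o card_fact \<mu>"
    proof (intro ballI impI)
      fix K assume K: "K \<in> P // Ha" "K \<subseteq> Hhat `` {f}"
      then obtain n Z where "bij_betw (\<lambda>s. assemble (s, n, Z)) (Bij (ran f)) K"
        using HK[OF K[unfolded hats']] by blast
      from ordIso_symmetric[OF card_of_ordIsoI[OF this]] show "|K| =o card_fact \<mu>"
        by (simp add: card_fact_def G BijGroup_def)
    qed
    have iv: "\<forall>K \<in> P // Ha. K \<subseteq> Hhat `` {f} \<longrightarrow> \<not> is_group_on K (sandwich a)"
      if "\<not> is_group_on (greenH (PT A A) pcomp `` {bar a f}) pcomp"
      using Hclass_group_imp_bar_group[OF fP] that by (auto simp: hats' A)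
    have v: "(\<forall>K \<in> P // Ha. K \<subseteq> Hhat `` {f} \<longrightarrow> is_group_iso_to K (sandwich a) (symmetric_group \<mu>)) \<and>
        rectangular_group (Hhat `` {f}) (sandwich a) ?\<rho> (Lam J) (symmetric_group \<mu>)"
      if grp: "is_group_on (greenH (PT A A) pcomp `` {bar a f}) pcomp"
    proof -
      obtain \<phi> where \<phi>: "permuted_by f \<phi>"
        using bar_group_imp_permuted[OF fP] grp by (auto simp: A)
      have "rectangular_group (Hhat_class f) (sandwich a) ?\<rho> (Lam J) (BijGroup (ran f))"
        unfolding \<rho>
        by (rule Hhat_class_rectangular_group[OF fP \<phi> card_normal_forms[OF fP] Card_order_cexp T LamC])
      then show ?thesis
        using Hclass_group[OF fP \<phi>] by (simp add: hats' G green P)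
    qed
    have D: "Dhat `` {f} = rank_class f" "Da `` {f} = rank_class f"
      using greenD_class[OF fP] by (simp_all add: hats' green')
    have via: "union_of_classes P ?\<sigma> Ra (Dhat `` {f})"
      unfolding D
    proof (rule union_of_classes_kernel[where k = pker, OF _ _ _ rk_R])
      show "Ra = {(x, y). x \<in> P \<and> y \<in> P \<and> pker x = pker y}"
        by (auto simp: green P greenR_iff)
      show "rank_class f \<subseteq> P" by (auto simp: rank_class_def P)
      show "y \<in> rank_class f" if "x \<in> rank_class f" "y \<in> P" "pker x = pker y" for x y
        using that ordIso_transitive[OF pker_eq_card_ran[of y x], of "|ran f|"]
        by (simp add: rank_class_def P)
    qed
    have vib: "union_of_classes P ?\<Sigma> La (Dhat `` {f})"
      unfolding D
    proof (rule union_of_classes_kernel[where k = ran, OF _ _ _ rk_L])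
      show "La = {(x, y). x \<in> P \<and> y \<in> P \<and> ran x = ran y}"
        by (auto simp: green P greenL_iff)
      show "rank_class f \<subseteq> P" by (auto simp: rank_class_def P)
      show "y \<in> rank_class f" if "x \<in> rank_class f" "y \<in> P" "ran x = ran y" for x y
        using that by (simp add: rank_class_def P)
    qed
    have vic: "union_of_classes P (?\<sigma> *c ?\<Sigma>) Ha (Dhat `` {f})"
      unfolding D green' P
    proof (rule union_of_H_classes[OF _ _ pker_ran_image_rank_class rk_R rk_L])
      show "rank_class f \<subseteq> RegPT X Y a" by (auto simp: rank_class_def)
      show "y \<in> rank_class f" if "x \<in> rank_class f" "y \<in> RegPT X Y a" "pker x = pker y" "ran x = ran y" for x y
        using that by (simp add: rank_class_def)
    qed
    show "union_of_classes P ?\<rho> Ra (Rhat `` {f}) \<and>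
        union_of_classes P (Lam J) La (Lhat `` {f}) \<and>
        (union_of_classes P (?\<rho> *c Lam J) Ha (Hhat `` {f}) \<and>
          (\<forall>K \<in> P // Ha. K \<subseteq> Hhat `` {f} \<longrightarrow> |K| =o card_fact \<mu>)) \<and>
        (\<not> is_group_on (greenH (PT A A) pcomp `` {bar a f}) pcomp \<longrightarrow>
          (\<forall>K \<in> P // Ha. K \<subseteq> Hhat `` {f} \<longrightarrow> \<not> is_group_on K (sandwich a))) \<and>
        (is_group_on (greenH (PT A A) pcomp `` {bar a f}) pcomp \<longrightarrow>
          (\<forall>K \<in> P // Ha. K \<subseteq> Hhat `` {f} \<longrightarrow>
             is_group_iso_to K (sandwich a) (symmetric_group \<mu>)) \<and>
          rectangular_group (Hhat `` {f}) (sandwich a) ?\<rho> (Lam J) (symmetric_group \<mu>)) \<and>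
        (Dhat `` {f} = Da `` {f} \<and> Da `` {f} = {g \<in> P. prank g =o \<mu>} \<and>
          union_of_classes P ?\<sigma> Ra (Dhat `` {f}) \<and>
          union_of_classes P ?\<Sigma> La (Dhat `` {f}) \<and>
          union_of_classes P (?\<sigma> *c ?\<Sigma>) Ha (Dhat `` {f}))"
      using D Dclass by (intro conjI impI i ii iii iii' iv v v[THEN conjunct1] v[THEN conjunct2] via vib vic) simp_all
  qed
qed

end
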